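(* Let $Q_{m,n}(x)$ ($m,n\in\mathbb{Z}$) be the functions obtained by evaluating the elements $\tau_{m,n}\in L$ at the rational solution $\alpha_0=\alpha_1=\alpha_2=1$, $\tau_0=\tau_1=\tau_2=1$ (so $\tau_j'=0$). Then every $Q_{m,n}(x)$ is a polynomial in $x$, and the family $(Q_{m,n})_{m,n\in\mathbb{Z}}$ is characterized by the Toda equations $$\big(\tfrac12D_x^2+x^2-1+2m-n\big)Q_{m,n}\cdot Q_{m,n}=Q_{m+1,n}Q_{m-1,n},$$ $$\big(\tfrac12D_x^2+x^2-m+2n\big)Q_{m,n}\cdot Q_{m,n}=Q_{m,n+1}Q_{m,n-1},$$ $$\big(\tfrac12D_x^2+x^2+1-m-n\big)Q_{m,n}\cdot Q_{m,n}=Q_{m-1,n-1}Q_{m+1,n+1}$$ (for all $m,n\in\mathbb{Z}$) together with the initial conditions $Q_{0,0}=Q_{1,0}=Q_{1,1}=1$, $Q_{2,1}=x$.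
   Context: Indices mod 3. $D_x^2F\cdot F=2(FF''-F'^2)$. Let $L$ be the field of rational functions over $\mathbb{C}$ in independent indeterminates $\alpha_0,\alpha_1,x,\tau_0,\tau_1,\tau_2,\tau_0',\tau_1',\tau_2'$, with $\alpha_2:=3-\alpha_0-\alpha_1$ and derivation $'$: $\alpha_i'=0$, $x'=1$, $(\tau_i)'=\tau_i'$, $(\tau_i')'=\tau_i(F_i''+(F_i')^2)$ where $F_j'=\tau_j'/\tau_j$ and $F_i''=-x(F_{i+1}'-F_{i+2}')-(F_i'-F_{i+1}')(F_i'-F_{i+2}')-(\alpha_{i+1}-\alpha_{i+2})/3$ (this encodes the bilinear fourth Painlevé system $(D_x^2-xD_x-(\alpha_i-\alpha_{i+1})/3)\tau_i\cdot\tau_{i+1}=0$). The extended affine Weyl group of type $A^{(1)}_2$ acts on $L$ by differential automorphisms $s_0,s_1,s_2,\pi$ with $s_i(x)=\pi(x)=x$, $s_i(\alpha_i)=-\alpha_i$, $s_i(\alpha_j)=\alpha_j+\alpha_i$ ($j\neq i$), $\pi(\alpha_j)=\alpha_{j+1}$, $s_i(\tau_i)=(\tau_{i+1}'\tau_{i+2}-\tau_{i+1}\tau_{i+2}'+x\tau_{i+1}\tau_{i+2})/\tau_i$, $s_i(\tau_j)=\tau_j$ ($j\ne i$), $\pi(\tau_j)=\tau_{j+1}$. Put $T_1=\pi s_2s_1$, $T_2=s_1\pi s_2$ and $\tau_{m,n}:=T_1^mT_2^n(\tau_0)\in L$. The $Q_{m,n}$ are called Okamoto polynomials. *)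

theory Defs
  imports "HOL-Library.Poly_Mapping" "HOL-Computational_Algebra.Fraction_Field"
          "HOL-Computational_Algebra.Polynomial"
begin

text \<open>The nine indeterminates of L:
  alpha_0, alpha_1, x, tau_0, tau_1, tau_2, tau_0', tau_1', tau_2'.\<close>
datatype var = Va0 | Va1 | Vx | Vt0 | Vt1 | Vt2 | Vd0 | Vd1 | Vd2

fun var_idx :: "var \<Rightarrow> nat" where
  "var_idx Va0 = 0" | "var_idx Va1 = 1" | "var_idx Vx = 2"
| "var_idx Vt0 = 3" | "var_idx Vt1 = 4" | "var_idx Vt2 = 5"
| "var_idx Vd0 = 6" | "var_idx Vd1 = 7" | "var_idx Vd2 = 8"

lemma var_idx_inj: "var_idx a = var_idx b \<Longrightarrow> a = b"
  by (cases a; cases b; simp)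

instantiation var :: linorder
begin
definition less_eq_var :: "var \<Rightarrow> var \<Rightarrow> bool" where
  "less_eq_var a b \<longleftrightarrow> var_idx a \<le> var_idx b"
definition less_var :: "var \<Rightarrow> var \<Rightarrow> bool" where
  "less_var a b \<longleftrightarrow> var_idx a < var_idx b"
instance
  by standard (auto simp: less_eq_var_def less_var_def intro: var_idx_inj)
end

type_synonym mpoly = "(var \<Rightarrow>\<^sub>0 nat) \<Rightarrow>\<^sub>0 complex"
type_synonym Lfld = "mpoly fract"

definition mconst :: "complex \<Rightarrow> Lfld" where
  "mconst c = Fraction_Field.Fract (Poly_Mapping.single 0 c) 1"

definition Var :: "var \<Rightarrow> Lfld" where
  "Var v = Fraction_Field.Fract (Poly_Mapping.single (Poly_Mapping.single v 1) 1) 1"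

definition evalm :: "(complex \<Rightarrow> 'b::comm_semiring_1) \<Rightarrow> (var \<Rightarrow> 'b) \<Rightarrow> mpoly \<Rightarrow> 'b" where
  "evalm c f p = (\<Sum>m\<in>Poly_Mapping.keys p. c (Poly_Mapping.lookup p m) * (\<Prod>v\<in>Poly_Mapping.keys m. f v ^ Poly_Mapping.lookup m v))"

definition rep :: "Lfld \<Rightarrow> mpoly \<times> mpoly" where
  "rep f = (SOME (a, b). b \<noteq> 0 \<and> f = Fraction_Field.Fract a b)"

definition tv :: "nat \<Rightarrow> var" where
  "tv i = (if i mod 3 = 0 then Vt0 else if i mod 3 = 1 then Vt1 else Vt2)"
definition dv :: "nat \<Rightarrow> var" where
  "dv i = (if i mod 3 = 0 then Vd0 else if i mod 3 = 1 then Vd1 else Vd2)"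

definition tau :: "nat \<Rightarrow> Lfld" where "tau i = Var (tv i)"
definition tau' :: "nat \<Rightarrow> Lfld" where "tau' i = Var (dv i)"
definition xL :: Lfld where "xL = Var Vx"

definition alpha :: "nat \<Rightarrow> Lfld" where
  "alpha i = (if i mod 3 = 0 then Var Va0 else if i mod 3 = 1 then Var Va1
              else 3 - Var Va0 - Var Va1)"

definition Fp :: "nat \<Rightarrow> Lfld" where "Fp j = tau' j / tau j"
definition Fpp :: "nat \<Rightarrow> Lfld" where
  "Fpp i = - xL * (Fp (i+1) - Fp (i+2)) - (Fp i - Fp (i+1)) * (Fp i - Fp (i+2))
           - (alpha (i+1) - alpha (i+2)) / 3"

fun dgen :: "var \<Rightarrow> Lfld" where
  "dgen Va0 = 0" | "dgen Va1 = 0" | "dgen Vx = 1"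
| "dgen Vt0 = tau' 0" | "dgen Vt1 = tau' 1" | "dgen Vt2 = tau' 2"
| "dgen Vd0 = tau 0 * (Fpp 0 + (Fp 0)^2)"
| "dgen Vd1 = tau 1 * (Fpp 1 + (Fp 1)^2)"
| "dgen Vd2 = tau 2 * (Fpp 2 + (Fp 2)^2)"

definition dpoly :: "mpoly \<Rightarrow> Lfld" where
  "dpoly p = (\<Sum>m\<in>Poly_Mapping.keys p. mconst (Poly_Mapping.lookup p m) *
      (\<Sum>v\<in>Poly_Mapping.keys m. of_nat (Poly_Mapping.lookup m v) *
         (\<Prod>w\<in>Poly_Mapping.keys m. Var w ^ (if w = v then Poly_Mapping.lookup m w - 1 else Poly_Mapping.lookup m w)) * dgen v))"

definition Lder :: "Lfld \<Rightarrow> Lfld" where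
  "Lder f = (case rep f of (a, b) \<Rightarrow>
     (dpoly a * Fraction_Field.Fract b 1 - Fraction_Field.Fract a 1 * dpoly b) / (Fraction_Field.Fract b 1)^2)"

definition subst :: "(var \<Rightarrow> Lfld) \<Rightarrow> Lfld \<Rightarrow> Lfld" where
  "subst \<sigma> f = (case rep f of (a, b) \<Rightarrow> evalm mconst \<sigma> a / evalm mconst \<sigma> b)"

definition new_tau :: "nat \<Rightarrow> Lfld" where
  "new_tau i = (tau' (i+1) * tau (i+2) - tau (i+1) * tau' (i+2) + xL * tau (i+1) * tau (i+2))
               / tau i"

definition s_alpha :: "nat \<Rightarrow> nat \<Rightarrow> Lfld" where
  "s_alpha i j = (if j mod 3 = i mod 3 then - alpha i else alpha j + alpha i)"

definition s_img_t :: "nat \<Rightarrow> nat \<Rightarrow> Lfld" where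
  "s_img_t i j = (if j mod 3 = i mod 3 then new_tau i else tau j)"
definition s_img_d :: "nat \<Rightarrow> nat \<Rightarrow> Lfld" where
  "s_img_d i j = (if j mod 3 = i mod 3 then Lder (new_tau i) else tau' j)"

fun s_gen :: "nat \<Rightarrow> var \<Rightarrow> Lfld" where
  "s_gen i Va0 = s_alpha i 0" | "s_gen i Va1 = s_alpha i 1" | "s_gen i Vx = xL"
| "s_gen i Vt0 = s_img_t i 0" | "s_gen i Vt1 = s_img_t i 1" | "s_gen i Vt2 = s_img_t i 2"
| "s_gen i Vd0 = s_img_d i 0" | "s_gen i Vd1 = s_img_d i 1" | "s_gen i Vd2 = s_img_d i 2"

fun pi_gen :: "var \<Rightarrow> Lfld" where
  "pi_gen Va0 = alpha 1" | "pi_gen Va1 = alpha 2" | "pi_gen Vx = xL"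
| "pi_gen Vt0 = tau 1" | "pi_gen Vt1 = tau 2" | "pi_gen Vt2 = tau 0"
| "pi_gen Vd0 = tau' 1" | "pi_gen Vd1 = tau' 2" | "pi_gen Vd2 = tau' 0"

text \<open>The inverse of pi (pi^2).\<close>
fun piinv_gen :: "var \<Rightarrow> Lfld" where
  "piinv_gen Va0 = alpha 2" | "piinv_gen Va1 = alpha 0" | "piinv_gen Vx = xL"
| "piinv_gen Vt0 = tau 2" | "piinv_gen Vt1 = tau 0" | "piinv_gen Vt2 = tau 1"
| "piinv_gen Vd0 = tau' 2" | "piinv_gen Vd1 = tau' 0" | "piinv_gen Vd2 = tau' 1"

definition s :: "nat \<Rightarrow> Lfld \<Rightarrow> Lfld" where "s i = subst (s_gen i)"
definition pi :: "Lfld \<Rightarrow> Lfld" where "pi = subst pi_gen"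
definition piinv :: "Lfld \<Rightarrow> Lfld" where "piinv = subst piinv_gen"

text \<open>T_1 = pi s_2 s_1, T_2 = s_1 pi s_2 and their inverses (s_i are involutions).\<close>
definition T1 :: "Lfld \<Rightarrow> Lfld" where "T1 = pi \<circ> s 2 \<circ> s 1"
definition T2 :: "Lfld \<Rightarrow> Lfld" where "T2 = s 1 \<circ> pi \<circ> s 2"
definition T1inv :: "Lfld \<Rightarrow> Lfld" where "T1inv = s 1 \<circ> s 2 \<circ> piinv"
definition T2inv :: "Lfld \<Rightarrow> Lfld" where "T2inv = s 2 \<circ> piinv \<circ> s 1"

definition zpow :: "('a \<Rightarrow> 'a) \<Rightarrow> ('a \<Rightarrow> 'a) \<Rightarrow> int \<Rightarrow> 'a \<Rightarrow> 'a" where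
  "zpow f finv k = (if k \<ge> 0 then f ^^ nat k else finv ^^ nat (- k))"

definition tau_mn :: "int \<Rightarrow> int \<Rightarrow> Lfld" where
  "tau_mn m n = zpow T1 T1inv m (zpow T2 T2inv n (tau 0))"

fun seed :: "var \<Rightarrow> complex poly" where
  "seed Va0 = 1" | "seed Va1 = 1" | "seed Vx = [:0, 1:]"
| "seed Vt0 = 1" | "seed Vt1 = 1" | "seed Vt2 = 1"
| "seed Vd0 = 0" | "seed Vd1 = 0" | "seed Vd2 = 0"

definition evseed :: "mpoly \<Rightarrow> complex poly" where
  "evseed = evalm (\<lambda>c. [:c:]) seed"

definition evaluates_to :: "Lfld \<Rightarrow> complex poly \<Rightarrow> bool" where
  "evaluates_to f q \<longleftrightarrow> (\<exists>a b. b \<noteq> 0 \<and> f = Fraction_Field.Fract a b \<and> evseed b \<noteq> 0 \<and>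
                               evseed a = q * evseed b)"

text \<open>(1/2) D_x^2 q.q = q q'' - q'^2.\<close>
definition half_hirota :: "complex poly \<Rightarrow> complex poly" where
  "half_hirota q = q * pderiv (pderiv q) - (pderiv q)^2"

definition toda_eqs :: "(int \<Rightarrow> int \<Rightarrow> complex poly) \<Rightarrow> bool" where
  "toda_eqs Q \<longleftrightarrow> (\<forall>m n.
     half_hirota (Q m n) + [:of_int (-1 + 2*m - n), 0, 1:] * (Q m n)^2 = Q (m+1) n * Q (m-1) n \<and>
     half_hirota (Q m n) + [:of_int (- m + 2*n), 0, 1:] * (Q m n)^2 = Q m (n+1) * Q m (n-1) \<and>
     half_hirota (Q m n) + [:of_int (1 - m - n), 0, 1:] * (Q m n)^2 = Q (m-1) (n-1) * Q (m+1) (n+1))"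

definition toda_init :: "(int \<Rightarrow> int \<Rightarrow> complex poly) \<Rightarrow> bool" where
  "toda_init Q \<longleftrightarrow> Q 0 0 = 1 \<and> Q 1 0 = 1 \<and> Q 1 1 = 1 \<and> Q 2 1 = [:0, 1:]"

end

theory Submission
  imports Defs "HOL-Computational_Algebra.Fundamental_Theorem_Algebra"
begin

text \<open>
  Evaluating \<open>s\<^sub>i f\<close> at a point of the parameter space amounts to evaluating \<open>f\<close> at the transformed
  point, so \<open>Q\<^sub>m\<^sub>,\<^sub>n\<close> is the \<open>\<tau>\<^sub>0\<close>-coordinate of the point obtained from the seed by the translation
  \<open>T\<^sub>1\<^sup>m T\<^sub>2\<^sup>n\<close>.  All points reached are triples of monic, squarefree, pairwise coprime polynomials
  satisfying the bilinear equations.  Indeed, let \<open>N = \<tau>\<^sub>2'\<tau>\<^sub>0 - \<tau>\<^sub>2\<tau>\<^sub>0' + x\<tau>\<^sub>2\<tau>\<^sub>0\<close>. The bilinear equations give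
  \<open>N'\<tau>\<^sub>1 - 2N\<tau>\<^sub>1' = \<alpha>\<^sub>1\<tau>\<^sub>0\<tau>\<^sub>1\<tau>\<^sub>2\<close>, so the squarefree \<open>\<tau>\<^sub>1\<close> divides \<open>N\<close> and \<open>u = N / \<tau>\<^sub>1\<close> is a polynomial with
  \<open>u'\<tau>\<^sub>1 - u\<tau>\<^sub>1' = \<alpha>\<^sub>1\<tau>\<^sub>0\<tau>\<^sub>2\<close>; coprimality to \<open>\<tau>\<^sub>0\<close> and \<open>\<tau>\<^sub>2\<close> is read off \<open>N\<close>, and \<open>u\<close> is squarefree because it
  solves a linear second-order equation with leading coefficient \<open>\<tau>\<^sub>0\<close>.  The Toda equations relate
  neighbouring points, whose coordinates agree by the braid relation; since the leading term of
  their left-hand side never vanishes, they determine all \<open>Q\<^sub>m\<^sub>,\<^sub>n\<close> from the initial conditions.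
\<close>

subsection \<open>Polynomial solutions of the bilinear equations\<close>

text \<open>Over the complex numbers divisibility is containment of root multisets. Each root of
  \<open>p\<close> is simple, so containment of the root sets suffices.\<close>

lemma dvd_if_squarefree_roots:
  fixes p q :: "complex poly"
  assumes "p \<noteq> 0" and q: "q \<noteq> 0"
    and sf: "\<And>a. poly p a = 0 \<Longrightarrow> poly (pderiv p) a \<noteq> 0"
    and roots: "\<And>a. poly p a = 0 \<Longrightarrow> poly q a = 0"
  shows "p dvd q"
proof -
  have "order a p \<le> order a q" for a
  proof (cases "poly p a = 0")
    case True
    then have "order a p = Suc (order a (pderiv p))"
      using assms(1) order_pderiv[of p a] sf[OF True] order_root by force
    also have "order a (pderiv p) = 0"
      using sf[OF True] by (rule order_0I)
    finally show ?thesis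
      using roots[OF True] q order_root[of q a] by linarith
  qed (simp add: order_0I)
  then have "proots p \<subseteq># proots q"
    using assms(1) q by (simp add: subseteq_mset_def)
  then have "(\<Prod>x\<in>#proots p. [:-x, 1:]) dvd (\<Prod>x\<in>#proots q. [:-x, 1:])"
    by (intro prod_mset_subset_imp_dvd image_mset_subseteq_mono)
  then have "smult (lead_coeff p) (\<Prod>x\<in>#proots p. [:-x, 1:])
      dvd smult (lead_coeff q) (\<Prod>x\<in>#proots q. [:-x, 1:])"
    using assms(1) q by (simp add: smult_dvd_iff dvd_smult_iff)
  then show ?thesis
    by (simp add: complex_poly_decompose_multiset)
qed

text \<open>A double zero of a solution at a regular point of the equation would lower
  the vanishing order of the leading term below that of the others.\<close>
lemma second_order_ode_no_double_root:
  fixes p q r u :: "'a::field_char_0 poly"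
  assumes ode: "p * pderiv (pderiv u) = q * pderiv u + r * u"
    and u: "u \<noteq> 0" and p: "poly p a \<noteq> 0"
    and root: "poly u a = 0"
  shows "poly (pderiv u) a \<noteq> 0"
proof
  assume root': "poly (pderiv u) a = 0"
  have u': "pderiv u \<noteq> 0"
    using u root pderiv_eq_0_iff[of u] by (auto elim!: degree_eq_zeroE)
  have u'': "pderiv (pderiv u) \<noteq> 0"
    using u' root' pderiv_eq_0_iff[of "pderiv u"] by (auto elim!: degree_eq_zeroE)
  let ?k = "order a (pderiv (pderiv u))"
  have k1: "order a (pderiv u) = Suc ?k"
    using u' root' order_pderiv[of "pderiv u" a] order_root by force
  then have k0: "order a u = Suc (Suc ?k)"
    using u u' root order_pderiv[of u a] order_root by force
  have "[:-a, 1:] ^ Suc ?k dvd q * pderiv u + r * u"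
    using k0 k1 by (intro dvd_add dvd_mult) (auto simp: order_divides simp del: power_Suc)
  moreover have "p * pderiv (pderiv u) \<noteq> 0"
    using p u'' by auto
  ultimately have "Suc ?k \<le> order a (p * pderiv (pderiv u))"
    unfolding ode[symmetric] by (simp add: order_divides del: power_Suc)
  also have "\<dots> = ?k"
    using \<open>p * _ \<noteq> 0\<close> p by (simp add: order_mult order_0I)
  finally show False by simp
qed

text \<open>In Hirota notation this is \<open>(D_x + x) p . q\<close>; thus \<open>br t2 t0\<close>
  is the numerator of \<open>s_1(tau_1)\<close>.\<close>

definition br :: "complex poly \<Rightarrow> complex poly \<Rightarrow> complex poly" where
  "br p q = pderiv p * q - p * pderiv q + [:0, 1:] * p * q"

text \<open>The bilinear equation \<open>(D_x^2 - x D_x - c/3) p . q = 0\<close>, multiplied by 3 to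
  stay free of fractions.\<close>

definition bilin :: "complex \<Rightarrow> complex poly \<Rightarrow> complex poly \<Rightarrow> bool" where
  "bilin c p q \<longleftrightarrow>
     3 * (pderiv (pderiv p) * q - 2 * pderiv p * pderiv q + p * pderiv (pderiv q)
       - [:0, 1:] * (pderiv p * q - p * pderiv q)) = [:c:] * p * q"

definition simple_roots :: "complex poly \<Rightarrow> bool" where
  "simple_roots p \<longleftrightarrow> (\<forall>a. poly p a = 0 \<longrightarrow> poly (pderiv p) a \<noteq> 0)"

definition no_common_root :: "complex poly \<Rightarrow> complex poly \<Rightarrow> bool" where
  "no_common_root p q \<longleftrightarrow> (\<forall>a. poly p a = 0 \<longrightarrow> poly q a \<noteq> 0)"

lemma degree_pderiv_mult_less:
  fixes p q :: "'a::field_char_0 poly"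
  assumes "p \<noteq> 0" "q \<noteq> 0"
  shows "degree (pderiv p * q) < Suc (degree p + degree q)"
  using degree_mult_le[of "pderiv p" q] by (simp add: degree_pderiv)

lemma lead_coeff_add_lower:
  fixes p q :: "'a::comm_ring_1 poly"
  assumes "degree q < degree p"
  shows "lead_coeff (p + q) = lead_coeff p"
  using assms by (simp add: coeff_eq_0 degree_add_eq_left)

text \<open>The term \<open>x p q\<close> has larger degree than both derivative terms.\<close>

lemma br_monic:
  assumes "lead_coeff p = 1" "lead_coeff q = 1"
  shows "lead_coeff (br p q) = 1" "br p q \<noteq> 0"
proof -
  let ?m = "[:0, 1:] * p * q"
  have nz: "p \<noteq> 0" "q \<noteq> 0" using assms by auto
  have deg: "degree ?m = Suc (degree p + degree q)"
    using nz by (simp add: degree_mult_eq)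
  have lc: "lead_coeff ?m = 1"
    unfolding lead_coeff_mult using assms by simp
  have "degree (pderiv p * q - p * pderiv q) < degree ?m"
    unfolding deg using degree_pderiv_mult_less[OF nz] degree_pderiv_mult_less[OF nz(2,1)]
    by (intro degree_diff_less) (simp_all add: ac_simps)
  from lead_coeff_add_lower[OF this] lc
  show "lead_coeff (br p q) = 1" by (simp add: br_def add.commute)
  then show "br p q \<noteq> 0" by auto
qed

lemma pderiv_br:
  "pderiv (br p q) = pderiv (pderiv p) * q - p * pderiv (pderiv q) + p * q
     + [:0, 1:] * (pderiv p * q + p * pderiv q)"
proof -
  have "pderiv [:0, 1::complex:] = 1" by (simp add: pderiv_pCons)
  then show ?thesis
    unfolding br_def pderiv_add pderiv_diff pderiv_mult by (simp add: algebra_simps)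
qed

text \<open>The invariant carried along the Weyl group orbit. By the cyclic symmetry
  \<open>rotate\<close> only the reflection in \<open>a1\<close> has to be treated.\<close>

locale bilinear_triple =
  fixes a0 a1 a2 :: complex and t0 t1 t2 :: "complex poly"
  assumes sum3: "a0 + a1 + a2 = 3"
    and monic: "lead_coeff t0 = 1" "lead_coeff t1 = 1" "lead_coeff t2 = 1"
    and simple: "simple_roots t0" "simple_roots t1" "simple_roots t2"
    and coprime: "no_common_root t0 t1" "no_common_root t1 t2" "no_common_root t2 t0"
    and bilin: "bilin (a0 - a1) t0 t1" "bilin (a1 - a2) t1 t2" "bilin (a2 - a0) t2 t0"
begin

lemma rotate: "bilinear_triple a1 a2 a0 t1 t2 t0"
  by unfold_locales (use sum3 monic simple coprime bilin in \<open>auto simp: algebra_simps\<close>)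

lemma nonzero: "t0 \<noteq> 0" "t1 \<noteq> 0" "t2 \<noteq> 0"
  using monic by auto

lemma const_sum: "[:a0:] = 3 - [:a1:] - [:a2:]"
  using sum3 by (simp add: numeral_poly algebra_simps)

text \<open>Take the second bilinear equation times \<open>t0\<close> minus the first times
  \<open>t2\<close>. As the parameters sum to 3, the coefficient on the right is
  \<open>a1 - 1\<close>; differentiating the factor \<open>x\<close> in \<open>br\<close> supplies
  the missing \<open>t0 t1 t2\<close>.\<close>

lemma br_hirota: "pderiv (br t2 t0) * t1 - 2 * pderiv t1 * br t2 t0 = [:a1:] * t0 * t1 * t2"
proof -
  have eqs: "3 * (pderiv (pderiv t0) * t1 - 2 * pderiv t0 * pderiv t1 + t0 * pderiv (pderiv t1)
       - [:0, 1:] * (pderiv t0 * t1 - t0 * pderiv t1)) = ([:a0:] - [:a1:]) * t0 * t1"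
    "3 * (pderiv (pderiv t1) * t2 - 2 * pderiv t1 * pderiv t2 + t1 * pderiv (pderiv t2)
       - [:0, 1:] * (pderiv t1 * t2 - t1 * pderiv t2)) = ([:a1:] - [:a2:]) * t1 * t2"
    using bilin by (simp_all add: bilin_def)
  have "3 * (pderiv (br t2 t0) * t1 - 2 * pderiv t1 * br t2 t0) = 3 * ([:a1:] * t0 * t1 * t2)"
    using eqs unfolding pderiv_br unfolding br_def const_sum by algebra
  then show ?thesis by (subst (asm) mult_cancel_left) simp
qed

lemma dvd_br: "t1 dvd br t2 t0"
proof (rule dvd_if_squarefree_roots)
  \<comment> \<open>At a root of \<open>t1\<close> only the term \<open>-2 t1' N\<close> of
    \<open>br_hirota\<close> survives, and \<open>t1'\<close> does not vanish there.\<close>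
  show "poly (br t2 t0) a = 0" if "poly t1 a = 0" for a
    using arg_cong[OF br_hirota, of "\<lambda>p. poly p a"] that simple(2)
    by (auto simp: simple_roots_def)
qed (use nonzero simple br_monic monic in \<open>auto simp: simple_roots_def\<close>)

text \<open>The value of \<open>s_1(tau_1)\<close> at the given triple.\<close>

definition u :: "complex poly" where "u = br t2 t0 div t1"

lemma u_mult: "u * t1 = br t2 t0"
  using dvd_br by (simp add: u_def)

text \<open>Inserting \<open>br t2 t0 = u t1\<close> into \<open>br_hirota\<close> makes every term
  divisible by \<open>t1\<close>.\<close>

lemma u_deriv: "pderiv u * t1 = u * pderiv t1 + [:a1:] * t0 * t2"
proof -
  have "pderiv (br t2 t0) = pderiv u * t1 + u * pderiv t1"
    unfolding u_mult[symmetric] by (simp add: pderiv_mult algebra_simps)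
  with br_hirota u_mult have "t1 * (pderiv u * t1) = t1 * (u * pderiv t1 + [:a1:] * t0 * t2)"
    by algebra
  then show ?thesis using nonzero by simp
qed

lemma u_deriv2:
  "pderiv (pderiv u) * t1 = u * pderiv (pderiv t1) + [:a1:] * (pderiv t0 * t2 + t0 * pderiv t2)"
proof -
  have "pderiv [:a1:] = 0" by simp
  then have "pderiv (pderiv u) * t1 + pderiv u * pderiv t1
    = pderiv u * pderiv t1 + u * pderiv (pderiv t1) + [:a1:] * (pderiv t0 * t2 + t0 * pderiv t2)"
    using arg_cong[OF u_deriv, of pderiv] unfolding pderiv_add pderiv_mult by algebra
  then show ?thesis by simp
qed

text \<open>After multiplication by \<open>t1\<close>, the derivatives of \<open>u\<close> are
  removed by \<open>u_deriv\<close> and \<open>u_deriv2\<close>. What remains is \<open>u\<close>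
  times the old equation plus \<open>a1 t0 N\<close> or \<open>- a1 t2 N\<close> with
  \<open>N = u t1\<close>, which accounts for the change of parameters.\<close>

lemma bilin_u: "bilin (a0 + a1 - - a1) t0 u" "bilin (- a1 - (a2 + a1)) u t2"
proof -
  have eqs: "3 * (pderiv (pderiv t0) * t1 - 2 * pderiv t0 * pderiv t1 + t0 * pderiv (pderiv t1)
       - [:0, 1:] * (pderiv t0 * t1 - t0 * pderiv t1)) = ([:a0:] - [:a1:]) * t0 * t1"
    "3 * (pderiv (pderiv t1) * t2 - 2 * pderiv t1 * pderiv t2 + t1 * pderiv (pderiv t2)
       - [:0, 1:] * (pderiv t1 * t2 - t1 * pderiv t2)) = ([:a1:] - [:a2:]) * t1 * t2"
    using bilin by (simp_all add: bilin_def)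
  have c: "[:a0 + a1 - - a1:] = [:a0:] + 2 * [:a1:]" "[:- a1 - (a2 + a1):] = - 2 * [:a1:] - [:a2:]"
    by (simp_all add: numeral_poly)
  let ?X = "[:0, 1::complex:]"
  note u = u_mult[unfolded br_def] u_deriv u_deriv2
  have "t1 * (3 * (pderiv (pderiv t0) * u - 2 * pderiv t0 * pderiv u + t0 * pderiv (pderiv u)
       - ?X * (pderiv t0 * u - t0 * pderiv u))) = t1 * (([:a0:] + 2 * [:a1:]) * t0 * u)"
    using u eqs(1) by algebra
  then show "bilin (a0 + a1 - - a1) t0 u"
    unfolding bilin_def c using nonzero by simp
  have "t1 * (3 * (pderiv (pderiv u) * t2 - 2 * pderiv u * pderiv t2 + u * pderiv (pderiv t2)
       - ?X * (pderiv u * t2 - u * pderiv t2))) = t1 * ((- 2 * [:a1:] - [:a2:]) * u * t2)"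
    using u eqs(2) by algebra
  then show "bilin (- a1 - (a2 + a1)) u t2"
    unfolding bilin_def c using nonzero by simp
qed

lemma u_monic: "lead_coeff u = 1"
proof -
  have "lead_coeff (u * t1) = 1"
    using u_mult br_monic monic by simp
  then show ?thesis using monic by (simp add: lead_coeff_mult)
qed

lemma u_coprime: "no_common_root t0 u" "no_common_root u t2"
proof -
  have *: "poly u a * poly t1 a = poly (pderiv t2) a * poly t0 a
      - poly t2 a * poly (pderiv t0) a + a * poly t2 a * poly t0 a" for a
    using arg_cong[OF u_mult, of "\<lambda>p. poly p a"] by (simp add: br_def)
  \<comment> \<open>If \<open>t0\<close> vanished as well, the formula would leave
    \<open>t2 t0' = 0\<close>, against simplicity and coprimality; likewise for
    \<open>t2\<close>.\<close>
  have "poly t0 a \<noteq> 0 \<and> poly t2 a \<noteq> 0" if "poly u a = 0" for a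
    using *[of a] that simple(1,3) coprime(3) by (auto simp: simple_roots_def no_common_root_def)
  then show "no_common_root t0 u" "no_common_root u t2"
    by (auto simp: no_common_root_def)
qed

lemma u_simple: "simple_roots u"
  unfolding simple_roots_def
proof (intro allI impI)
  fix a assume a: "poly u a = 0"
  have u: "u \<noteq> 0" using u_monic by auto
  have b: "3 * (pderiv (pderiv t0) * u - 2 * pderiv t0 * pderiv u + t0 * pderiv (pderiv u)
       - [:0, 1:] * (pderiv t0 * u - t0 * pderiv u)) = [:a0 + a1 - - a1:] * t0 * u"
    using bilin_u(1) by (simp only: bilin_def)
  show "poly (pderiv u) a \<noteq> 0"
  proof (rule second_order_ode_no_double_root[OF _ u _ a])
    show "poly (3 * t0) a \<noteq> 0"
      using u_coprime(1) a by (auto simp: no_common_root_def)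
    show "3 * t0 * pderiv (pderiv u) = (6 * pderiv t0 - 3 * [:0, 1:] * t0) * pderiv u
      + ([:a0 + a1 - - a1:] * t0 - 3 * pderiv (pderiv t0) + 3 * [:0, 1:] * pderiv t0) * u"
      using b by algebra
  qed
qed

lemma reflect: "bilinear_triple (a0 + a1) (- a1) (a2 + a1) t0 u t2"
  by unfold_locales
    (use sum3 monic simple coprime bilin u_monic u_simple u_coprime bilin_u
      in \<open>simp_all add: algebra_simps\<close>)

end

subsection \<open>The affine Weyl group on polynomial solutions\<close>

type_synonym state = "complex \<times> complex \<times> complex \<times> complex poly \<times> complex poly \<times> complex poly"

text \<open>A state lists the values of the \<open>\<alpha>\<^sub>i\<close> and \<open>\<tau>\<^sub>i\<close> at a polynomial solution; the values of the
  \<open>\<tau>\<^sub>i'\<close> are the derivatives of the latter.\<close>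
definition good :: "state \<Rightarrow> bool" where
  "good X = (case X of (a0, a1, a2, t0, t1, t2) \<Rightarrow> bilinear_triple a0 a1 a2 t0 t1 t2)"

fun rot :: "state \<Rightarrow> state" where
  "rot (a0, a1, a2, t0, t1, t2) = (a1, a2, a0, t1, t2, t0)"

fun rotinv :: "state \<Rightarrow> state" where
  "rotinv (a0, a1, a2, t0, t1, t2) = (a2, a0, a1, t2, t0, t1)"

fun refl1 :: "state \<Rightarrow> state" where
  "refl1 (a0, a1, a2, t0, t1, t2) = (a0 + a1, - a1, a2 + a1, t0, br t2 t0 div t1, t2)"

abbreviation refl2 :: "state \<Rightarrow> state" where
  "refl2 X \<equiv> rotinv (refl1 (rot X))"

lemma rot_rotinv [simp]: "rot (rotinv X) = X" "rotinv (rot X) = X"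
  and rot_rot [simp]: "rot (rot X) = rotinv X" "rotinv (rotinv X) = rot X"
  by (cases X; simp)+

lemma good_rot [simp]: "good (rot X) = good X"
  and good_rotinv [simp]: "good (rotinv X) = good X"
proof -
  have *: "good (rot X)" if "good X" for X
    using that bilinear_triple.rotate by (cases X) (auto simp: good_def)
  show "good (rot X) = good X"
    using *[of X] *[of "rot X"] *[of "rot (rot X)"] by auto
  show "good (rotinv X) = good X"
    using *[of X] *[of "rot X"] *[of "rot (rot X)"] by auto
qed

lemma good_refl1: "good X \<Longrightarrow> good (refl1 X)"
  using bilinear_triple.reflect by (cases X) (auto simp: good_def bilinear_triple.u_def)

lemma (in bilinear_triple) u_nonzero: "u \<noteq> 0"
  using u_monic by auto

text \<open>The numerator \<open>br t2 t0 = u t1\<close> does not involve the middle coordinate, so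
  dividing it by \<open>u\<close> returns \<open>t1\<close>.\<close>

lemma refl1_refl1 [simp]: "good X \<Longrightarrow> refl1 (refl1 X) = X"
proof (cases X)
  case [simp]: (fields a0 a1 a2 t0 t1 t2)
  assume "good X"
  then interpret bilinear_triple a0 a1 a2 t0 t1 t2 by (simp add: good_def)
  have "br t2 t0 div u = t1"
    unfolding u_mult[symmetric] using u_nonzero by simp
  then show ?thesis by (simp add: u_def)
qed

section \<open>Neighbouring tau functions, their products and the braid relation\<close>

context bilinear_triple
begin

text \<open>\<open>v\<close> is the new third tau after \<open>refl2\<close>, \<open>u_minus\<close>
  the one after \<open>refl1\<close> and then \<open>refl2\<close>, and \<open>w\<close> the new
  middle tau after \<open>refl2\<close> and then \<open>refl1\<close>. Together with
  \<open>t1\<close>, \<open>t2\<close> and \<open>u\<close> these are the six lattice neighbours of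
  \<open>t0\<close>, in opposite pairs \<open>t1\<close>, \<open>u_minus\<close>; \<open>u\<close>,
  \<open>v\<close>; and \<open>t2\<close>, \<open>w\<close>.\<close>

definition v :: "complex poly" where "v = br t0 t1 div t2"
definition u_minus :: "complex poly" where "u_minus = br t0 u div t2"
definition w :: "complex poly" where "w = br v t0 div t1"

lemma v_mult: "v * t2 = br t0 t1"
  and v_deriv: "pderiv v * t2 = v * pderiv t2 + [:a2:] * t1 * t0"
  using bilinear_triple.u_mult[OF rotate] bilinear_triple.u_deriv[OF rotate]
  by (simp_all add: bilinear_triple.u_def[OF rotate] v_def)

lemma u_minus_mult: "u_minus * t2 = br t0 u"
  and u_minus_deriv: "pderiv u_minus * t2 = u_minus * pderiv t2 + ([:a1:] + [:a2:]) * u * t0"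
  using bilinear_triple.v_mult[OF reflect] bilinear_triple.v_deriv[OF reflect]
  unfolding bilinear_triple.v_def[OF reflect] u_minus_def by (simp_all add: add.commute)

lemma reflect2: "bilinear_triple (a0 + a2) (a1 + a2) (- a2) t0 t1 v"
  using bilinear_triple.rotate[OF bilinear_triple.rotate[OF bilinear_triple.reflect[OF rotate]]]
  by (simp add: bilinear_triple.u_def[OF rotate] v_def)

lemma w_mult: "w * t1 = br v t0"
  and w_deriv: "pderiv w * t1 = w * pderiv t1 + ([:a1:] + [:a2:]) * t0 * v"
  using bilinear_triple.u_mult[OF reflect2] bilinear_triple.u_deriv[OF reflect2]
  by (simp_all add: bilinear_triple.u_def[OF reflect2] w_def)

text \<open>Products of opposite neighbours differ only by multiples of \<open>t0^2\<close>, so one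
  Toda equation will yield all three. Here \<open>u_deriv\<close> turns \<open>t1 (br t0 u)\<close>
  into \<open>u (br t0 t1)\<close> plus such a multiple of \<open>t2\<close>.\<close>

lemma u_minus_t1: "u_minus * t1 = u * v - [:a1:] * t0^2"
proof -
  have "t2 * (u_minus * t1) = t2 * (u * v - [:a1:] * t0^2)"
    using u_minus_mult[unfolded br_def] v_mult[unfolded br_def] u_deriv by algebra
  then show ?thesis using nonzero by simp
qed

lemma w_t2: "w * t2 = u * v + [:a2:] * t0^2"
proof -
  have "t1 * (w * t2) = t1 * (u * v + [:a2:] * t0^2)"
    using w_mult[unfolded br_def] u_mult[unfolded br_def] v_deriv by algebra
  then show ?thesis using nonzero by simp
qed

text \<open>The first bilinear equation times \<open>t2\<close> plus the third times
  \<open>t1\<close> minus the second times \<open>t0\<close> contains no \<open>t1''\<close> or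
  \<open>t2''\<close>, but \<open>2 t0'' t1 t2\<close>. Multiplied by \<open>t0\<close>, its
  first-order terms match those in \<open>2 (br t2 t0) (br t0 t1) = 2 u v t1 t2\<close>.\<close>

lemma toda_uv:
  "3 * (half_hirota t0 + [:0, 1:]^2 * t0^2) + [:a1 - a2:] * t0^2 = 3 * (u * v)"
proof -
  have c: "[:a1 - a2:] = [:a1:] - [:a2:]" by simp
  have eqs: "3 * (pderiv (pderiv t0) * t1 - 2 * pderiv t0 * pderiv t1 + t0 * pderiv (pderiv t1)
       - [:0, 1:] * (pderiv t0 * t1 - t0 * pderiv t1)) = ([:a0:] - [:a1:]) * t0 * t1"
    "3 * (pderiv (pderiv t1) * t2 - 2 * pderiv t1 * pderiv t2 + t1 * pderiv (pderiv t2)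
       - [:0, 1:] * (pderiv t1 * t2 - t1 * pderiv t2)) = ([:a1:] - [:a2:]) * t1 * t2"
    "3 * (pderiv (pderiv t2) * t0 - 2 * pderiv t2 * pderiv t0 + t2 * pderiv (pderiv t0)
       - [:0, 1:] * (pderiv t2 * t0 - t2 * pderiv t0)) = ([:a2:] - [:a0:]) * t2 * t0"
    using bilin by (simp_all add: bilin_def)
  have "2 * t1 * t2 * (3 * (half_hirota t0 + [:0, 1:]^2 * t0^2) + ([:a1:] - [:a2:]) * t0^2)
      = 2 * t1 * t2 * (3 * (u * v))"
    using eqs u_mult[unfolded br_def] v_mult[unfolded br_def]
    unfolding half_hirota_def by algebra
  then show ?thesis
    unfolding c using nonzero by (subst (asm) mult_cancel_left) simp
qed

text \<open>These are the two nontrivial tau coordinates of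
  \<open>s_1 s_2 s_1 = s_2 s_1 s_2\<close>. They hold because \<open>w t2\<close> and
  \<open>u_minus t1\<close> differ by \<open>(a1 + a2) t0^2\<close>, the same coefficient that
  occurs in \<open>u_minus_deriv\<close> and \<open>w_deriv\<close>.\<close>

lemma braid_triple:
  "br u_minus t0 div u = w" "br t0 w div v = u_minus"
proof -
  have um: "bilinear_triple.v t0 u t2 = u_minus"
    by (simp add: bilinear_triple.v_def[OF reflect] u_minus_def)
  note refl_u = bilinear_triple.reflect2[OF reflect, unfolded um]
  have c: "(br u_minus t0 div u) * u = br u_minus t0"
    using bilinear_triple.u_mult[OF refl_u] unfolding bilinear_triple.u_def[OF refl_u] .
  have "t2 * u * (br u_minus t0 div u) = t2 * u * w"
    using c[unfolded br_def] u_minus_deriv w_t2 u_minus_t1 u_mult[unfolded br_def]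
    unfolding br_def by algebra
  then show "br u_minus t0 div u = w" using nonzero u_nonzero by simp
  have wm: "bilinear_triple.u t0 t1 v = w"
    by (simp add: bilinear_triple.u_def[OF reflect2] w_def)
  note refl_v = bilinear_triple.reflect[OF reflect2, unfolded wm]
  have e: "(br t0 w div v) * v = br t0 w"
    using bilinear_triple.v_mult[OF refl_v] unfolding bilinear_triple.v_def[OF refl_v] .
  have v: "v \<noteq> 0" using bilinear_triple.nonzero(3)[OF reflect2] .
  have "t1 * v * (br t0 w div v) = t1 * v * u_minus"
    using e[unfolded br_def] w_deriv w_t2 u_minus_t1 v_mult[unfolded br_def]
    unfolding br_def by algebra
  then show "br t0 w div v = u_minus" using nonzero v by simp
qed

end

lemma braid: "good X \<Longrightarrow> refl1 (refl2 (refl1 X)) = refl2 (refl1 (refl2 X))"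
proof (cases X)
  case [simp]: (fields a0 a1 a2 t0 t1 t2)
  assume "good X"
  then interpret bilinear_triple a0 a1 a2 t0 t1 t2 by (simp add: good_def)
  show ?thesis
    using braid_triple by (simp add: u_def v_def w_def u_minus_def)
qed

text \<open>Since \<open>s\<^sub>2 = \<pi> s\<^sub>1 \<pi>\<inverse>\<close> and \<open>\<pi>\<^sup>3 = 1\<close>, we have
  \<open>T\<^sub>1 = (\<pi>\<inverse> s\<^sub>1)\<^sup>2\<close> and \<open>T\<^sub>2 = (s\<^sub>1 \<pi>\<inverse>)\<^sup>2\<close>; the factors appear here in reversed order
  because substitutions act on points from the right.\<close>
definition shift1 :: "state \<Rightarrow> state" where
  "shift1 X = refl1 (rotinv (refl1 (rotinv X)))"
definition shift2 :: "state \<Rightarrow> state" where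
  "shift2 X = rotinv (refl1 (rotinv (refl1 X)))"
definition shift1_inv :: "state \<Rightarrow> state" where
  "shift1_inv X = rot (refl1 (rot (refl1 X)))"
definition shift2_inv :: "state \<Rightarrow> state" where
  "shift2_inv X = refl1 (rot (refl1 (rot X)))"

lemmas shift_defs = shift1_def shift2_def shift1_inv_def shift2_inv_def

lemma good_shift [simp]:
  "good X \<Longrightarrow> good (shift1 X)" "good X \<Longrightarrow> good (shift2 X)"
  "good X \<Longrightarrow> good (shift1_inv X)" "good X \<Longrightarrow> good (shift2_inv X)"
  by (simp_all add: shift_defs good_refl1)

lemma shift_inverse [simp]:
  assumes "good X"
  shows "shift1 (shift1_inv X) = X" "shift1_inv (shift1 X) = X"
    "shift2 (shift2_inv X) = X" "shift2_inv (shift2 X) = X"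
  using assms by (simp_all add: shift_defs good_refl1)

text \<open>The two inner reflections cancel, so the diagonal neighbour is also just two reflections
  away.\<close>

lemma shift2_shift1: "good X \<Longrightarrow> shift2 (shift1 X) = rotinv (refl1 (rot (refl1 (rotinv X))))"
  by (simp add: shift_defs good_refl1)

lemma shift1_inv_shift2_inv:
  "good X \<Longrightarrow> shift1_inv (shift2_inv X) = rot (refl1 (rotinv (refl1 (rot X))))"
  by (simp add: shift_defs good_refl1)

lemma shift_commute:
  assumes "good X"
  shows "shift1 (shift2 X) = shift2 (shift1 X)"
proof -
  \<comment> \<open>Seen from this state, the two composites are the two sides of the braid
    relation.\<close>
  let ?Y = "rotinv (refl1 X)"
  have "shift1 (shift2 X) = refl1 (refl2 (refl1 ?Y))"
    by (simp add: shift_defs)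
  also have "\<dots> = refl2 (refl1 (refl2 ?Y))"
    using assms by (intro braid) (simp add: good_refl1)
  also have "\<dots> = shift2 (shift1 X)"
    using assms by (simp add: shift2_shift1)
  finally show ?thesis .
qed

section \<open>Integer powers of the translations and the lattice of states\<close>

lemma zpow_step:
  fixes k :: int
  assumes inv: "\<And>X. good X \<Longrightarrow> good (f X)" "\<And>X. good X \<Longrightarrow> good (g X)"
    "\<And>X. good X \<Longrightarrow> f (g X) = X" "\<And>X. good X \<Longrightarrow> g (f X) = X"
    and X: "good X"
  shows "good (zpow f g k X)" "zpow f g (k + 1) X = f (zpow f g k X)"
    "zpow f g (k - 1) X = g (zpow f g k X)"
proof -
  have gf: "good ((f ^^ n) X)" "good ((g ^^ n) X)" for n
    using inv(1,2) X by (induction n) auto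
  then show "good (zpow f g k X)" by (simp add: zpow_def)
  have step: "zpow f g (k + 1) X = f (zpow f g k X)" for k
  proof (cases "k \<ge> 0")
    case True
    then have "nat (k + 1) = Suc (nat k)" by simp
    with True show ?thesis by (simp add: zpow_def)
  next
    case False
    then have "nat (- k) = Suc (nat (- (k + 1)))" by simp
    with False gf inv(3) show ?thesis by (auto simp: zpow_def)
  qed
  show "zpow f g (k + 1) X = f (zpow f g k X)" by (rule step)
  have good: "good (zpow f g (k - 1) X)" using gf by (simp add: zpow_def)
  show "zpow f g (k - 1) X = g (zpow f g k X)"
    using step[of "k - 1"] inv(4)[OF good] by simp
qed

lemmas zpow_shift1 = zpow_step[of shift1 shift1_inv, simplified]
lemmas zpow_shift2 = zpow_step[of shift2 shift2_inv, simplified]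

lemma zpow_shift2_shift1:
  assumes "good X"
  shows "zpow shift2 shift2_inv n (shift1 X) = shift1 (zpow shift2 shift2_inv n X)"
proof (induction n rule: int_induct[where k = 0])
  case base
  show ?case by (simp add: zpow_def)
next
  case (step1 i)
  then show ?case using assms by (simp add: zpow_shift2 shift_commute)
next
  case (step2 i)
  have "shift2_inv (shift1 Y) = shift1 (shift2_inv Y)" if "good Y" for Y
    using shift_commute[of "shift2_inv Y"] that
      shift_inverse(4)[of "shift1 (shift2_inv Y)"] by simp
  with step2 show ?case using assms by (simp add: zpow_shift2)
qed

definition seed_state :: state where "seed_state = (1, 1, 1, 1, 1, 1)"

lemma good_seed [simp]: "good seed_state"
  unfolding seed_state_def good_def
  by (simp, unfold_locales) (auto simp: simple_roots_def no_common_root_def bilin_def)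

text \<open>\<open>T1\<close> is outermost in \<open>tau_mn\<close>; since the order reverses on
  points, its shift acts first on the seed.\<close>

definition lattice :: "int \<Rightarrow> int \<Rightarrow> state" where
  "lattice m n = zpow shift2 shift2_inv n (zpow shift1 shift1_inv m seed_state)"

lemma good_lattice [simp]: "good (lattice m n)"
  by (simp add: lattice_def zpow_shift1 zpow_shift2)

lemma lattice_step:
  "lattice (m + 1) n = shift1 (lattice m n)" "lattice m (n + 1) = shift2 (lattice m n)"
  "lattice (m - 1) n = shift1_inv (lattice m n)" "lattice m (n - 1) = shift2_inv (lattice m n)"
proof -
  have 1: "lattice (m + 1) n = shift1 (lattice m n)" for m
    by (simp add: lattice_def zpow_shift1 zpow_shift2_shift1)
  show "lattice (m + 1) n = shift1 (lattice m n)" by (rule 1)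
  show "lattice (m - 1) n = shift1_inv (lattice m n)" using 1[of "m - 1"] by simp
qed (simp_all add: lattice_def zpow_shift1 zpow_shift2)

fun tau_zero :: "state \<Rightarrow> complex poly" where
  "tau_zero (a0, a1, a2, t0, t1, t2) = t0"

definition okamoto :: "int \<Rightarrow> int \<Rightarrow> complex poly" where
  "okamoto m n = tau_zero (lattice m n)"

fun params :: "state \<Rightarrow> complex \<times> complex \<times> complex" where
  "params (a0, a1, a2, t0, t1, t2) = (a0, a1, a2)"

text \<open>The shifts act on the parameters as translations by 3 because
  \<open>a0 + a1 + a2 = 3\<close>, which is extracted from \<open>good X\<close>.\<close>

lemma params_shift:
  assumes "good X" "params X = (a0, a1, a2)"
  shows "params (shift1 X) = (a0 + 3, a1 - 3, a2)"
    "params (shift2 X) = (a0, a1 + 3, a2 - 3)"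
    "params (shift1_inv X) = (a0 - 3, a1 + 3, a2)"
    "params (shift2_inv X) = (a0, a1 - 3, a2 + 3)"
proof -
  obtain t0 t1 t2 where [simp]: "X = (a0, a1, a2, t0, t1, t2)"
    using assms(2) by (cases X) auto
  have "a0 + a1 + a2 = 3"
    using assms(1) by (simp add: good_def bilinear_triple_def)
  then have [simp]: "a2 = 3 - a0 - a1" by (simp add: algebra_simps)
  show "params (shift1 X) = (a0 + 3, a1 - 3, a2)"
    "params (shift2 X) = (a0, a1 + 3, a2 - 3)"
    "params (shift1_inv X) = (a0 - 3, a1 + 3, a2)"
    "params (shift2_inv X) = (a0, a1 - 3, a2 + 3)"
    by (simp_all add: shift_defs)
qed

text \<open>This makes the Toda coefficients integers; for example \<open>(a1 - a2) / 3\<close>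
  becomes \<open>- m + 2 * n\<close>.\<close>

lemma params_lattice:
  "params (lattice m n) = (1 + 3 * of_int m, 1 - 3 * of_int m + 3 * of_int n, 1 - 3 * of_int n)"
proof (induction n rule: int_induct[where k = 0])
  case base
  show ?case
  proof (induction m rule: int_induct[where k = 0])
    case base
    show ?case by (simp add: lattice_def zpow_def seed_state_def)
  next
    case (step1 i)
    from params_shift(1)[OF good_lattice step1(2)] show ?case
      unfolding lattice_step by (simp add: algebra_simps)
  next
    case (step2 i)
    from params_shift(3)[OF good_lattice step2(2)] show ?case
      unfolding lattice_step by (simp add: algebra_simps)
  qed
next
  case (step1 i)
  from params_shift(2)[OF good_lattice step1(2)] show ?case
    unfolding lattice_step by (simp add: algebra_simps)
next
  case (step2 i)
  from params_shift(4)[OF good_lattice step2(2)] show ?case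
    unfolding lattice_step by (simp add: algebra_simps)
qed

section \<open>Toda equations and initial values on the lattice\<close>

lemma toda_normalize:
  assumes "3 * (half_hirota t + [:0, 1:]^2 * t^2) + [:c:] * t^2 = 3 * p" "c = 3 * k"
  shows "half_hirota t + [:k, 0, 1:] * t^2 = p"
proof -
  have "[:k, 0, 1:] = [:0, 1:]^2 + [:k:]" "[:c:] = 3 * [:k:]"
    using assms(2) by (simp_all add: power2_eq_square numeral_poly)
  with assms(1) have "3 * (half_hirota t + [:k, 0, 1:] * t^2) = 3 * p"
    by (simp only:) algebra
  then show ?thesis by (subst (asm) mult_cancel_left) simp
qed

text \<open>All three equations are \<open>toda_uv\<close>: replacing \<open>u v\<close> by another
  product of opposite neighbours changes the coefficient \<open>a1 - a2\<close> by
  \<open>- 3 a1\<close> (via \<open>u_minus_t1\<close>) or by \<open>3 a2\<close> (via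
  \<open>w_t2\<close>).\<close>

lemma toda_good:
  assumes "good X" "params X = (a0, a1, a2)"
  defines "t \<equiv> tau_zero X"
  shows "- 2 * a1 - a2 = 3 * k1 \<Longrightarrow> half_hirota t + [:k1, 0, 1:] * t^2
      = tau_zero (shift1 X) * tau_zero (shift1_inv X)"
    and "a1 - a2 = 3 * k2 \<Longrightarrow> half_hirota t + [:k2, 0, 1:] * t^2
      = tau_zero (shift2 X) * tau_zero (shift2_inv X)"
    and "a1 + 2 * a2 = 3 * k3 \<Longrightarrow> half_hirota t + [:k3, 0, 1:] * t^2
      = tau_zero (shift1_inv (shift2_inv X)) * tau_zero (shift2 (shift1 X))"
proof -
  obtain t0 t1 t2 where X [simp]: "X = (a0, a1, a2, t0, t1, t2)"
    using assms(2) by (cases X) auto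
  have [simp]: "t = t0" by (simp add: t_def)
  interpret bilinear_triple a0 a1 a2 t0 t1 t2
    using assms(1) by (simp add: good_def)
  have z: "tau_zero (shift1 X) = t1" "tau_zero (shift1_inv X) = u_minus"
    "tau_zero (shift2 X) = u" "tau_zero (shift2_inv X) = v"
    by (simp_all add: shift_defs u_def v_def u_minus_def)
  have z': "tau_zero (shift1_inv (shift2_inv X)) = w" "tau_zero (shift2 (shift1 X)) = t2"
    unfolding shift1_inv_shift2_inv[OF assms(1)] shift2_shift1[OF assms(1)]
    by (simp_all add: v_def w_def)
  have c: "[:- 2 * a1 - a2:] = [:a1 - a2:] - 3 * [:a1:]" "[:a1 + 2 * a2:] = [:a1 - a2:] + 3 * [:a2:]"
    by (simp_all add: numeral_poly)
  show "half_hirota t + [:k1, 0, 1:] * t^2 = tau_zero (shift1 X) * tau_zero (shift1_inv X)"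
    if "- 2 * a1 - a2 = 3 * k1"
    unfolding z
  proof (rule toda_normalize[OF _ that])
    show "3 * (half_hirota t + [:0, 1:]^2 * t^2) + [:- 2 * a1 - a2:] * t^2 = 3 * (t1 * u_minus)"
      unfolding c \<open>t = t0\<close> using toda_uv u_minus_t1 by algebra
  qed
  show "half_hirota t + [:k2, 0, 1:] * t^2 = tau_zero (shift2 X) * tau_zero (shift2_inv X)"
    if "a1 - a2 = 3 * k2"
    unfolding z using toda_normalize[OF toda_uv that] by simp
  show "half_hirota t + [:k3, 0, 1:] * t^2
      = tau_zero (shift1_inv (shift2_inv X)) * tau_zero (shift2 (shift1 X))"
    if "a1 + 2 * a2 = 3 * k3"
    unfolding z'
  proof (rule toda_normalize[OF _ that])
    show "3 * (half_hirota t + [:0, 1:]^2 * t^2) + [:a1 + 2 * a2:] * t^2 = 3 * (w * t2)"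
      unfolding c \<open>t = t0\<close> using toda_uv w_t2 by algebra
  qed
qed

lemma toda_okamoto: "toda_eqs okamoto"
proof -
  have diag: "lattice (m - 1) (n - 1) = shift1_inv (shift2_inv (lattice m n))"
    "lattice (m + 1) (n + 1) = shift2 (shift1 (lattice m n))" for m n
    using lattice_step(3)[of m "n - 1"] lattice_step(4)[of m n]
      lattice_step(1)[of m n] lattice_step(2)[of "m + 1" n] by simp_all
  show ?thesis
    unfolding toda_eqs_def okamoto_def diag unfolding lattice_step
    by (intro allI conjI toda_good[OF good_lattice params_lattice]) (simp_all add: algebra_simps)
qed

lemma init_okamoto: "toda_init okamoto"
proof -
  have br1: "br 1 1 = [:0, 1:]" by (simp add: br_def)
  have 0: "lattice 0 0 = seed_state" by (simp add: lattice_def zpow_def)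
  have 1: "lattice 1 0 = shift1 seed_state" using lattice_step(1)[of 0 0] 0 by simp
  have 11: "lattice 1 1 = shift2 (shift1 seed_state)" using lattice_step(2)[of 1 0] 1 by simp
  have "lattice 2 0 = shift1 (shift1 seed_state)" using lattice_step(1)[of 1 0] 1 by simp
  then have 21: "lattice 2 1 = shift2 (shift1 (shift1 seed_state))"
    using lattice_step(2)[of 2 0] by simp
  show ?thesis
    \<comment> \<open>The first tau of the diagonal neighbour is the third tau of the state itself,
      so the values 1 and x at (1,1) and (2,1) are those third taus at the seed and at its first
      shift.\<close>
    unfolding toda_init_def okamoto_def 0 1 11 21 shift2_shift1[OF good_shift(1)[OF good_seed]]
      shift2_shift1[OF good_seed]
    by (simp add: shift_defs seed_state_def br1)
qed

section \<open>Uniqueness of solutions of the Toda equations\<close>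

lemma toda_step_nonzero:
  fixes q :: "int \<Rightarrow> complex poly"
  assumes toda: "\<And>k. half_hirota (q k) + [:c k, 0, 1:] * (q k)^2 = q (k + 1) * q (k - 1)"
    and nz: "q 0 \<noteq> 0" "q 1 \<noteq> 0"
  shows "q k \<noteq> 0"
proof -
  have rhs: "q (k + 1) * q (k - 1) \<noteq> 0" if "q k \<noteq> 0" for k
  proof (cases "degree (q k) = 0")
    case True
    then obtain b where b: "q k = [:b:]" by (auto elim: degree_eq_zeroE)
    then show ?thesis using that unfolding toda[symmetric] b
      by (simp add: half_hirota_def power2_eq_square)
  next
    case False
    let ?m = "[:c k, 0, 1:] * (q k)^2"
    have m: "degree ?m = 2 + 2 * degree (q k)"
      using that degree_mult_eq[of "[:c k, 0, 1:]" "(q k)^2"] by (simp add: degree_power_eq del: mult_pCons_left)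
    \<comment> \<open>The Hirota part cannot cancel the leading term of \<open>x^2 (q k)^2\<close>,
      so the product of the neighbours is nonzero.\<close>
    have "degree (half_hirota (q k)) \<le> 2 * degree (q k)"
      unfolding half_hirota_def
    proof (rule degree_diff_le)
      show "degree (q k * pderiv (pderiv (q k))) \<le> 2 * degree (q k)"
        using degree_mult_le[of "q k" "pderiv (pderiv (q k))"] by (simp add: degree_pderiv)
      show "degree ((pderiv (q k))\<^sup>2) \<le> 2 * degree (q k)"
        using degree_power_le[of "pderiv (q k)" 2] by (simp add: degree_pderiv)
    qed
    then have "degree (half_hirota (q k) + ?m) = 2 + 2 * degree (q k)"
      using m by (subst degree_add_eq_right) auto
    then show ?thesis unfolding toda by auto
  qed
  \<comment> \<open>A claim about consecutive pairs lets the second-order recurrence be run in both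
    directions.\<close>
  have "q k \<noteq> 0 \<and> q (k + 1) \<noteq> 0" for k
  proof (induction k rule: int_induct[where k = 0])
    case base
    show ?case using nz by simp
  next
    case (step1 i)
    then show ?case using rhs[of "i + 1"] by (auto simp: algebra_simps)
  next
    case (step2 i)
    then show ?case using rhs[of i] by auto
  qed
  then show ?thesis by blast
qed

lemma toda_step_unique:
  fixes p q :: "int \<Rightarrow> complex poly"
  assumes p: "\<And>k. half_hirota (p k) + [:c k, 0, 1:] * (p k)^2 = p (k + 1) * p (k - 1)"
    and q: "\<And>k. half_hirota (q k) + [:c k, 0, 1:] * (q k)^2 = q (k + 1) * q (k - 1)"
    and nz: "q 0 \<noteq> 0" "q 1 \<noteq> 0"
    and init: "p 0 = q 0" "p 1 = q 1"
  shows "p k = q k"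
proof -
  have step: "p (k + 1) * p (k - 1) = q (k + 1) * q (k - 1)" if "p k = q k" for k
    using p[of k] q[of k] that by simp
  have nz: "q k \<noteq> 0" for k
    using toda_step_nonzero[OF q nz] .
  have "p k = q k \<and> p (k + 1) = q (k + 1)" for k
  proof (induction k rule: int_induct[where k = 0])
    case base
    show ?case using init by simp
  next
    case (step1 i)
    then show ?case using step[of "i + 1"] nz[of i] by (auto simp: algebra_simps)
  next
    case (step2 i)
    then show ?case using step[of i] nz[of "i + 1"] by auto
  qed
  then show ?thesis by blast
qed

text \<open>The first equation determines the rows \<open>n = 0\<close> and \<open>n = 1\<close>
  from the two initial values given in each; the second then determines every column from these two
  rows.\<close>

lemma toda_unique:
  assumes P: "toda_eqs P" "toda_init P" and Q: "toda_eqs Q" "toda_init Q"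
  shows "P = Q"
proof (intro ext)
  fix m n
  have row: "half_hirota (R m n) + [:of_int (-1 + 2*m - n), 0, 1:] * (R m n)^2
      = R (m + 1) n * R (m - 1) n"
    and col: "half_hirota (R m n) + [:of_int (- m + 2*n), 0, 1:] * (R m n)^2
      = R m (n + 1) * R m (n - 1)" if "toda_eqs R" for R m n
    using that unfolding toda_eqs_def by blast+
  have init: "Q 0 0 \<noteq> 0" "Q 1 0 \<noteq> 0" "Q 1 1 \<noteq> 0" "Q 2 1 \<noteq> 0"
    "P 0 0 = Q 0 0" "P 1 0 = Q 1 0" "P 1 1 = Q 1 1" "P 2 1 = Q 2 1"
    using P Q by (auto simp: toda_init_def)
  have 0: "P m 0 = Q m 0" "Q m 0 \<noteq> 0"
    using toda_step_unique[of "\<lambda>k. P k 0" _ "\<lambda>k. Q k 0" m,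
        OF row[OF P(1), of _ 0] row[OF Q(1), of _ 0] init(1,2,5,6)]
      toda_step_nonzero[of "\<lambda>k. Q k 0" _ m, OF row[OF Q(1), of _ 0] init(1,2)] by simp_all
  \<comment> \<open>The index is shifted by one because the initial values of this row sit at 1 and
    2, not at 0 and 1.\<close>
  have row': "half_hirota (R (k + 1) 1) + [:of_int (-1 + 2*(k + 1) - 1), 0, 1:] * (R (k + 1) 1)^2
      = R (k + 1 + 1) 1 * R (k - 1 + 1) 1" if "toda_eqs R" for R k
    using row[OF that, of "k + 1" 1] by (simp add: algebra_simps)
  have init': "Q (0 + 1) 1 \<noteq> 0" "Q (1 + 1) 1 \<noteq> 0"
    "P (0 + 1) 1 = Q (0 + 1) 1" "P (1 + 1) 1 = Q (1 + 1) 1"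
    using init by simp_all
  have 1: "P m 1 = Q m 1" "Q m 1 \<noteq> 0"
    using toda_step_unique[of "\<lambda>k. P (k + 1) 1" _ "\<lambda>k. Q (k + 1) 1" "m - 1",
        OF row'[OF P(1)] row'[OF Q(1)] init']
      toda_step_nonzero[of "\<lambda>k. Q (k + 1) 1" _ "m - 1", OF row'[OF Q(1)] init'(1,2)] by simp_all
  show "P m n = Q m n"
    by (rule toda_step_unique[OF col[OF P(1)] col[OF Q(1)] 0(2) 1(2) 0(1) 1(1)])
qed

subsection \<open>Evaluation of rational functions\<close>

lemma poly_mapping_add_induct [case_names zero single add]:
  fixes f :: "'a \<Rightarrow>\<^sub>0 'b::comm_monoid_add"
  assumes "P 0" "\<And>k v. P (Poly_Mapping.single k v)" "\<And>f g. P f \<Longrightarrow> P g \<Longrightarrow> P (f + g)"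
  shows "P f"
proof (induction f rule: update_induct)
  case const
  show ?case by (rule assms(1))
next
  case (update f a b)
  have "Poly_Mapping.update a b f = f + Poly_Mapping.single a b"
    using update(1) by (intro poly_mapping_eqI)
      (auto simp: lookup_update lookup_add lookup_single when_def in_keys_iff)
  then show ?case using assms(2,3) update by metis
qed

instance var :: finite
proof
  have "(UNIV :: var set) \<subseteq> {Va0, Va1, Vx, Vt0, Vt1, Vt2, Vd0, Vd1, Vd2}"
    by (auto intro: var.exhaust)
  then show "finite (UNIV :: var set)" by (rule finite_subset) simp
qed

text \<open>A product over all of the finite type \<open>var\<close>, instead of the support of
  \<open>m\<close>, makes multiplicativity in \<open>m\<close> immediate.\<close>

definition mono_eval :: "(var \<Rightarrow> 'b) \<Rightarrow> (var \<Rightarrow>\<^sub>0 nat) \<Rightarrow> 'b::comm_semiring_1" where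
  "mono_eval f m = (\<Prod>v\<in>UNIV. f v ^ Poly_Mapping.lookup m v)"

lemma prod_keys_eq_mono_eval:
  "(\<Prod>v\<in>Poly_Mapping.keys m. f v ^ Poly_Mapping.lookup m v) = mono_eval f m"
  unfolding mono_eval_def by (rule prod.mono_neutral_left) (auto simp: in_keys_iff)

lemma mono_eval_add: "mono_eval f (m + n) = mono_eval f m * mono_eval f n"
  by (simp add: mono_eval_def lookup_add power_add prod.distrib)

lemma mono_eval_0 [simp]: "mono_eval f 0 = 1"
  by (simp add: mono_eval_def)

lemma mono_eval_single [simp]: "mono_eval f (Poly_Mapping.single v n) = f v ^ n"
proof -
  have "mono_eval f (Poly_Mapping.single v n) = (\<Prod>w\<in>UNIV. if w = v then f v ^ n else 1)"
    unfolding mono_eval_def by (rule prod.cong) (auto simp: lookup_single when_def)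
  then show ?thesis by simp
qed

text \<open>The common shape of \<open>evalm\<close> and \<open>dpoly\<close>, so that additivity is
  proved once for both.\<close>

definition lin_ext ::
  "('k \<Rightarrow> 'b::comm_semiring_1) \<Rightarrow> ('m \<Rightarrow> 'b) \<Rightarrow> ('m \<Rightarrow>\<^sub>0 'k::comm_monoid_add) \<Rightarrow> 'b" where
  "lin_ext c g p = (\<Sum>m\<in>Poly_Mapping.keys p. c (Poly_Mapping.lookup p m) * g m)"

lemma lin_ext_add:
  assumes "c 0 = 0" "\<And>a b. c (a + b) = c a + c b"
  shows "lin_ext c g (p + q) = lin_ext c g p + lin_ext c g q"
proof -
  let ?K = "Poly_Mapping.keys p \<union> Poly_Mapping.keys q"
  have *: "lin_ext c g r = (\<Sum>m\<in>?K. c (Poly_Mapping.lookup r m) * g m)"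
    if "Poly_Mapping.keys r \<subseteq> ?K" for r
    unfolding lin_ext_def using that assms(1)
    by (intro sum.mono_neutral_left) (auto simp: in_keys_iff)
  show ?thesis
    using assms(2) keys_add[of p q]
    by (subst (1 2 3) *) (auto simp: lookup_add distrib_right sum.distrib)
qed

lemma lin_ext_single:
  "c 0 = 0 \<Longrightarrow> lin_ext c g (Poly_Mapping.single m k) = c k * g m"
  by (auto simp: lin_ext_def)

text \<open>Two instances matter: \<open>mconst\<close>, for values in L, and constant polynomials,
  for values at a state.\<close>

locale const_hom =
  fixes c :: "complex \<Rightarrow> 'b::idom"
  assumes c0 [simp]: "c 0 = 0" and c1 [simp]: "c 1 = 1"
    and c_add: "c (a + b) = c a + c b" and c_mult: "c (a * b) = c a * c b"
begin

lemma evalm_lin_ext: "evalm c f p = lin_ext c (mono_eval f) p"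
  by (simp add: evalm_def lin_ext_def prod_keys_eq_mono_eval)

lemma evalm_add: "evalm c f (p + q) = evalm c f p + evalm c f q"
  unfolding evalm_lin_ext by (rule lin_ext_add) (simp_all add: c_add)

lemma evalm_single: "evalm c f (Poly_Mapping.single m k) = c k * mono_eval f m"
  unfolding evalm_lin_ext by (simp add: lin_ext_single)

lemma evalm_0 [simp]: "evalm c f 0 = 0"
  by (simp add: evalm_def)

lemma evalm_1 [simp]: "evalm c f 1 = 1"
  unfolding single_one[symmetric] evalm_single by simp

lemma evalm_mult: "evalm c f (p * q) = evalm c f p * evalm c f q"
proof (induction p rule: poly_mapping_add_induct)
  case (single m k)
  show ?case
    by (induction q rule: poly_mapping_add_induct)
      (simp_all add: distrib_left evalm_add mult_single evalm_single mono_eval_add c_mult)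
qed (simp_all add: distrib_right evalm_add)

lemma evalm_uminus: "evalm c f (- p) = - evalm c f p"
  using evalm_add[of f p "- p"] by (simp add: minus_unique)

lemma evalm_Var: "evalm c f (Poly_Mapping.single (Poly_Mapping.single v 1) 1) = f v"
  by (simp add: evalm_single)

text \<open>The value at \<open>p\<close> of an element of the local ring of fractions defined at \<open>p\<close>.\<close>
definition ev_at :: "(var \<Rightarrow> 'b) \<Rightarrow> Lfld \<Rightarrow> 'b \<Rightarrow> bool" where
  "ev_at p f q \<longleftrightarrow> (\<exists>a b. evalm c p b \<noteq> 0 \<and> f = Fraction_Field.Fract a b \<and>
     evalm c p a = q * evalm c p b)"

lemma evalm_nonzeroD: "evalm c p b \<noteq> 0 \<Longrightarrow> b \<noteq> 0"
  by auto

lemma ev_at_unique: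
  assumes "ev_at p f q" "ev_at p f r"
  shows "q = r"
proof -
  obtain a b where ab: "evalm c p b \<noteq> 0" "f = Fraction_Field.Fract a b"
    "evalm c p a = q * evalm c p b"
    using assms(1) unfolding ev_at_def by blast
  obtain a' b' where ab': "evalm c p b' \<noteq> 0" "f = Fraction_Field.Fract a' b'"
    "evalm c p a' = r * evalm c p b'"
    using assms(2) unfolding ev_at_def by blast
  have "a * b' = a' * b"
    using ab ab' evalm_nonzeroD by (metis eq_fract(1))
  then have "evalm c p a * evalm c p b' = evalm c p a' * evalm c p b"
    by (metis evalm_mult)
  with ab ab' show ?thesis by (simp add: mult.commute mult.left_commute)
qed

lemma ev_at_Fract: "ev_at p (Fraction_Field.Fract a 1) (evalm c p a)"
  unfolding ev_at_def by (intro exI[of _ a] exI[of _ 1]) simp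

lemma ev_at_mconst: "ev_at p (mconst k) (c k)"
  using ev_at_Fract[of p "Poly_Mapping.single 0 k"] by (simp add: mconst_def evalm_single)

lemma ev_at_Var: "ev_at p (Var v) (p v)"
  using ev_at_Fract[of p "Poly_Mapping.single (Poly_Mapping.single v 1) 1"]
  unfolding evalm_Var Var_def .

lemma ev_at_0: "ev_at p 0 0" and ev_at_1: "ev_at p 1 1"
  using ev_at_Fract[of p 0] ev_at_Fract[of p 1] by (simp_all add: fract_collapse)

lemma ev_at_add:
  assumes "ev_at p f q" "ev_at p g r"
  shows "ev_at p (f + g) (q + r)"
proof -
  obtain a b a' b' where *: "evalm c p b \<noteq> 0" "f = Fraction_Field.Fract a b"
    "evalm c p a = q * evalm c p b" "evalm c p b' \<noteq> 0" "g = Fraction_Field.Fract a' b'"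
    "evalm c p a' = r * evalm c p b'"
    using assms by (auto simp: ev_at_def)
  then show ?thesis
    unfolding ev_at_def
    by (intro exI[of _ "a * b' + a' * b"] exI[of _ "b * b'"])
      (auto simp: evalm_mult evalm_add algebra_simps dest!: evalm_nonzeroD)
qed

lemma ev_at_mult:
  assumes "ev_at p f q" "ev_at p g r"
  shows "ev_at p (f * g) (q * r)"
proof -
  obtain a b a' b' where *: "evalm c p b \<noteq> 0" "f = Fraction_Field.Fract a b"
    "evalm c p a = q * evalm c p b" "evalm c p b' \<noteq> 0" "g = Fraction_Field.Fract a' b'"
    "evalm c p a' = r * evalm c p b'"
    using assms by (auto simp: ev_at_def)
  then show ?thesis
    unfolding ev_at_def
    by (intro exI[of _ "a * a'"] exI[of _ "b * b'"]) (auto simp: evalm_mult)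
qed

text \<open>The values lie in an integral domain without division, so the value of the numerator is
  required in factored form.\<close>

lemma ev_at_divide:
  assumes "ev_at p f (q * r)" "ev_at p g r" "r \<noteq> 0"
  shows "ev_at p (f / g) q"
proof -
  obtain a b a' b' where *: "evalm c p b \<noteq> 0" "f = Fraction_Field.Fract a b"
    "evalm c p a = (q * r) * evalm c p b" "evalm c p b' \<noteq> 0" "g = Fraction_Field.Fract a' b'"
    "evalm c p a' = r * evalm c p b'"
    using assms by (auto simp: ev_at_def)
  with assms(3) show ?thesis
    unfolding ev_at_def
    by (intro exI[of _ "a * b'"] exI[of _ "b * a'"]) (auto simp: evalm_mult)
qed

lemma ev_at_uminus: "ev_at p f q \<Longrightarrow> ev_at p (- f) (- q)"
  using ev_at_mult[OF ev_at_mconst[of p "- 1"]] c_add[of 1 "- 1"]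
    ev_at_unique ev_at_mult[OF ev_at_Fract[of p "- 1"]]
  by (fastforce simp: evalm_uminus fract_collapse simp flip: minus_fract One_fract_def)

lemma ev_at_diff: "ev_at p f q \<Longrightarrow> ev_at p g r \<Longrightarrow> ev_at p (f - g) (q - r)"
  using ev_at_add[OF _ ev_at_uminus, of p f q g r] by simp

lemma ev_at_power: "ev_at p f q \<Longrightarrow> ev_at p (f ^ n) (q ^ n)"
  by (induction n) (auto intro: ev_at_mult ev_at_1)

lemma ev_at_3: "ev_at p 3 3"
  using ev_at_add[OF ev_at_add[OF ev_at_1 ev_at_1] ev_at_1, of p] by simp

lemmas ev_at_intros = ev_at_add ev_at_mult ev_at_uminus ev_at_diff ev_at_power ev_at_3 ev_at_Var

lemma ev_at_prod:
  "(\<And>v. v \<in> A \<Longrightarrow> ev_at p (f v) (q v)) \<Longrightarrow> ev_at p (\<Prod>v\<in>A. f v) (\<Prod>v\<in>A. q v)"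
  by (induction A rule: infinite_finite_induct) (auto intro: ev_at_mult ev_at_1)

lemma ev_at_sum:
  "(\<And>v. v \<in> A \<Longrightarrow> ev_at p (f v) (q v)) \<Longrightarrow> ev_at p (\<Sum>v\<in>A. f v) (\<Sum>v\<in>A. q v)"
  by (induction A rule: infinite_finite_induct) (auto intro: ev_at_add ev_at_0)

lemma ev_at_evalm:
  assumes "\<And>v. ev_at p (\<sigma> v) (p' v)"
  shows "ev_at p (evalm mconst \<sigma> a) (evalm c p' a)"
  unfolding evalm_def
  by (intro ev_at_sum ev_at_mult ev_at_mconst ev_at_prod ev_at_power assms)

end

lemma rep_Fract:
  obtains a b where "rep f = (a, b)" "b \<noteq> 0" "f = Fraction_Field.Fract a b"
proof -
  obtain a b where "f = Fraction_Field.Fract a b" "b \<noteq> 0" by (cases f)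
  then have "\<exists>ab. case ab of (a, b) \<Rightarrow> b \<noteq> 0 \<and> f = Fraction_Field.Fract a b" by auto
  then have "case rep f of (a, b) \<Rightarrow> b \<noteq> 0 \<and> f = Fraction_Field.Fract a b"
    unfolding rep_def by (rule someI_ex)
  then show ?thesis using that by (cases "rep f") auto
qed

interpretation mconst: const_hom mconst
  by unfold_locales
    (simp_all add: mconst_def fract_collapse single_add mult_single)

lemma Var_nonzero [simp]: "Var v \<noteq> 0"
proof -
  let ?m = "Poly_Mapping.single v 1 :: var \<Rightarrow>\<^sub>0 nat"
  have "Poly_Mapping.lookup (Poly_Mapping.single ?m (1 :: complex)) ?m \<noteq> 0" by simp
  then have "Poly_Mapping.single ?m (1 :: complex) \<noteq> 0" by (metis lookup_zero)
  then show ?thesis by (simp add: Var_def Zero_fract_def eq_fract)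
qed

lemma mono_eval_Var: "mono_eval Var m = Fraction_Field.Fract (Poly_Mapping.single m 1) 1"
proof (induction m rule: poly_mapping_add_induct)
  case zero
  show ?case by (simp add: fract_collapse)
next
  case (single v n)
  have "Var v ^ n = Fraction_Field.Fract (Poly_Mapping.single (Poly_Mapping.single v n) 1) 1"
  proof (induction n)
    case (Suc n)
    have "Poly_Mapping.single v (Suc n) = Poly_Mapping.single v 1 + Poly_Mapping.single v n"
      by (simp flip: single_add)
    with Suc show ?case by (simp add: Var_def mult_single)
  qed (simp add: fract_collapse)
  then show ?case by simp
next
  case (add m n)
  then show ?case by (simp add: mono_eval_add mult_single)
qed

lemma evalm_mconst_Var: "evalm mconst Var a = Fraction_Field.Fract a 1"
proof (induction a rule: poly_mapping_add_induct)
  case zero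
  show ?case by (simp add: fract_collapse)
next
  case (single m k)
  show ?case
    unfolding mconst.evalm_single mono_eval_Var by (simp add: mconst_def mult_single)
next
  case (add p q)
  then show ?case by (simp add: mconst.evalm_add)
qed

definition injective_subst :: "(var \<Rightarrow> Lfld) \<Rightarrow> bool" where
  "injective_subst \<sigma> \<longleftrightarrow> (\<forall>b. evalm mconst \<sigma> b = 0 \<longrightarrow> b = 0)"

text \<open>The extension of \<open>\<rho>\<close> to its local ring is a left inverse of \<open>\<sigma>\<close> on polynomials.  Without
  injectivity \<^const>\<open>subst\<close> could divide by zero and depend on the representative.\<close>
lemma injective_substI:
  assumes "\<And>v. mconst.ev_at \<rho> (\<sigma> v) (Var v)"
  shows "injective_subst \<sigma>"
  unfolding injective_subst_def
proof (intro allI impI)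
  fix b assume "evalm mconst \<sigma> b = 0"
  with mconst.ev_at_evalm[of \<rho> \<sigma> Var b] assms
  have "mconst.ev_at \<rho> 0 (Fraction_Field.Fract b 1)"
    by (simp add: evalm_mconst_Var)
  then have "Fraction_Field.Fract b 1 = 0"
    using mconst.ev_at_unique mconst.ev_at_0 by blast
  then show "b = 0" by (simp add: Zero_fract_def eq_fract)
qed

text \<open>The representative picked by \<open>rep\<close> may have a denominator vanishing at
  \<open>p'\<close>. Injectivity keeps its image and that of the good denominator nonzero, so the
  cross-multiplied relation permits passing to the good fraction before evaluating.\<close>

lemma (in const_hom) ev_at_subst:
  assumes inj: "injective_subst \<sigma>"
    and gen: "\<And>v. ev_at p (\<sigma> v) (p' v)"
    and f: "ev_at p' f q"
  shows "ev_at p (subst \<sigma> f) q"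
proof -
  obtain a b where ab: "evalm c p' b \<noteq> 0" "f = Fraction_Field.Fract a b"
    "evalm c p' a = q * evalm c p' b"
    using f by (auto simp: ev_at_def)
  obtain a' b' where rep: "rep f = (a', b')" "b' \<noteq> 0" "f = Fraction_Field.Fract a' b'"
    by (rule rep_Fract)
  have b: "b \<noteq> 0" using ab by auto
  have "a * b' = a' * b"
    using ab(2) rep(2,3) b by (simp add: eq_fract)
  then have "evalm mconst \<sigma> a * evalm mconst \<sigma> b' = evalm mconst \<sigma> a' * evalm mconst \<sigma> b"
    by (metis mconst.evalm_mult)
  moreover have "evalm mconst \<sigma> b \<noteq> 0" "evalm mconst \<sigma> b' \<noteq> 0"
    using inj rep(2) b by (auto simp: injective_subst_def)
  ultimately have "subst \<sigma> f = evalm mconst \<sigma> a / evalm mconst \<sigma> b"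
    by (simp add: subst_def rep(1) frac_eq_eq)
  moreover have "ev_at p (evalm mconst \<sigma> a / evalm mconst \<sigma> b) q"
    using ev_at_evalm[of p \<sigma> p', OF gen, of a] ev_at_evalm[of p \<sigma> p', OF gen, of b] ab(1,3)
    by (intro ev_at_divide[of p _ q "evalm c p' b"]) auto
  ultimately show ?thesis by simp
qed

section \<open>The derivation on L: Leibniz and quotient rules\<close>

definition log_deriv :: "(var \<Rightarrow>\<^sub>0 nat) \<Rightarrow> Lfld" where
  "log_deriv m = (\<Sum>v\<in>UNIV. of_nat (Poly_Mapping.lookup m v) * (dgen v / Var v))"

text \<open>This additivity is the Leibniz rule for monomials; \<open>dpoly_mult\<close> extends it
  bilinearly.\<close>

lemma log_deriv_add: "log_deriv (m + n) = log_deriv m + log_deriv n"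
  by (simp add: log_deriv_def lookup_add distrib_right add_divide_distrib sum.distrib)

lemma dpoly_lin_ext: "dpoly = lin_ext mconst (\<lambda>m. mono_eval Var m * log_deriv m)"
proof -
  have "(\<Sum>v\<in>Poly_Mapping.keys m. of_nat (Poly_Mapping.lookup m v) *
         (\<Prod>w\<in>Poly_Mapping.keys m. Var w ^ (if w = v then Poly_Mapping.lookup m w - 1
            else Poly_Mapping.lookup m w)) * dgen v) = mono_eval Var m * log_deriv m" for m
  proof -
    have "(\<Prod>w\<in>Poly_Mapping.keys m. Var w ^ (if w = v then Poly_Mapping.lookup m w - 1
            else Poly_Mapping.lookup m w)) = mono_eval Var m / Var v"
      if "v \<in> Poly_Mapping.keys m" for v
    proof -
      \<comment> \<open>A key of \<open>m\<close> has positive exponent, so the truncated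
        subtraction is harmless.\<close>
      have "Var v ^ Poly_Mapping.lookup m v = Var v * Var v ^ (Poly_Mapping.lookup m v - 1)"
        using that by (metis in_keys_iff power_eq_if)
      then show ?thesis
        unfolding prod_keys_eq_mono_eval[symmetric]
        by (simp add: prod.remove[OF _ that])
    qed
    then have "(\<Sum>v\<in>Poly_Mapping.keys m. of_nat (Poly_Mapping.lookup m v) *
         (\<Prod>w\<in>Poly_Mapping.keys m. Var w ^ (if w = v then Poly_Mapping.lookup m w - 1
            else Poly_Mapping.lookup m w)) * dgen v)
        = (\<Sum>v\<in>Poly_Mapping.keys m. mono_eval Var m *
            (of_nat (Poly_Mapping.lookup m v) * (dgen v / Var v)))"
      by (intro sum.cong) auto
    also have "\<dots> = (\<Sum>v\<in>UNIV. mono_eval Var m *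
            (of_nat (Poly_Mapping.lookup m v) * (dgen v / Var v)))"
      by (rule sum.mono_neutral_left) (auto simp: in_keys_iff)
    finally show ?thesis by (simp add: log_deriv_def sum_distrib_left)
  qed
  then show ?thesis by (simp add: dpoly_def lin_ext_def fun_eq_iff)
qed

lemma dpoly_add: "dpoly (p + q) = dpoly p + dpoly q"
  unfolding dpoly_lin_ext by (rule lin_ext_add) (simp_all add: mconst.c_add)

lemma dpoly_single:
  "dpoly (Poly_Mapping.single m k) = mconst k * (mono_eval Var m * log_deriv m)"
  unfolding dpoly_lin_ext by (simp add: lin_ext_single)

lemma dpoly_mult:
  "dpoly (p * q) = dpoly p * Fraction_Field.Fract q 1 + Fraction_Field.Fract p 1 * dpoly q"
  unfolding evalm_mconst_Var[symmetric]
proof (induction p rule: poly_mapping_add_induct)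
  case zero
  show ?case by (simp add: dpoly_def)
next
  case (single m k)
  show ?case
  proof (induction q rule: poly_mapping_add_induct)
    case zero
    show ?case by (simp add: dpoly_def)
  next
    case (single n l)
    show ?case
      by (simp add: mult_single dpoly_single mconst.evalm_single mconst.c_mult mono_eval_add
          log_deriv_add algebra_simps)
  qed (simp add: distrib_left dpoly_add mconst.evalm_add)
qed (simp add: distrib_right dpoly_add mconst.evalm_add)

lemma Fract_eq_divide: "Fraction_Field.Fract a b = Fraction_Field.Fract a 1 / Fraction_Field.Fract b 1"
  by simp

lemma Fract_1_eq_0_iff: "Fraction_Field.Fract a 1 = 0 \<longleftrightarrow> a = 0"
  by (simp add: Zero_fract_def eq_fract)

text \<open>\<open>Lder\<close> is independent of the representative: the Leibniz rule applied to
  \<open>a b' = a' b\<close> identifies the two quotient-rule expressions.\<close>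

lemma Lder_divide:
  assumes "b \<noteq> 0"
  shows "Lder (Fraction_Field.Fract a b) =
    (dpoly a * Fraction_Field.Fract b 1 - Fraction_Field.Fract a 1 * dpoly b)
      / (Fraction_Field.Fract b 1)^2"
proof -
  let ?e = "\<lambda>a :: mpoly. Fraction_Field.Fract a 1"
  obtain a' b' where rep: "rep (Fraction_Field.Fract a b) = (a', b')" "b' \<noteq> 0"
    "Fraction_Field.Fract a b = Fraction_Field.Fract a' b'"
    by (rule rep_Fract)
  have "a * b' = a' * b"
    using rep(2,3) assms by (simp add: eq_fract)
  then have 1: "?e a * ?e b' = ?e a' * ?e b"
    and 2: "dpoly a * ?e b' + ?e a * dpoly b' = dpoly a' * ?e b + ?e a' * dpoly b"
    using dpoly_mult[of a b'] dpoly_mult[of a' b] by simp_all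
  have nz: "?e b \<noteq> 0" "?e b' \<noteq> 0"
    using assms rep(2) by (simp_all add: Fract_1_eq_0_iff)
  have "(dpoly a' * ?e b' - ?e a' * dpoly b') * (?e b)^2
      = (dpoly a * ?e b - ?e a * dpoly b) * (?e b')^2"
    using 1 2 by algebra
  then show ?thesis
    using nz by (simp add: Lder_def rep(1) frac_eq_eq del: mult_fract divide_fract)
qed

lemma Lder_mult: "Lder (f * g) = Lder f * g + f * Lder g"
  and Lder_add: "Lder (f + g) = Lder f + Lder g"
proof -
  let ?e = "\<lambda>a :: mpoly. Fraction_Field.Fract a 1"
  obtain a b where f: "f = Fraction_Field.Fract a b" "b \<noteq> 0" by (cases f)
  obtain a' b' where g: "g = Fraction_Field.Fract a' b'" "b' \<noteq> 0" by (cases g)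
  have nz: "?e b \<noteq> 0" "?e b' \<noteq> 0"
    using f g by (simp_all add: Fract_1_eq_0_iff)
  have e: "?e (x * y) = ?e x * ?e y" "?e (x + y) = ?e x + ?e y" for x y
    by simp_all
  have bb: "b * b' \<noteq> 0" using f g by simp
  show "Lder (f * g) = Lder f * g + f * Lder g"
    unfolding f(1) g(1) mult_fract Lder_divide[OF f(2)] Lder_divide[OF g(2)] Lder_divide[OF bb]
    unfolding Fract_eq_divide[of a b] Fract_eq_divide[of a' b'] dpoly_mult e
    using nz by (simp add: divide_simps del: mult_fract divide_fract) algebra
  show "Lder (f + g) = Lder f + Lder g"
    unfolding f(1) g(1) add_fract[OF f(2) g(2)] Lder_divide[OF f(2)] Lder_divide[OF g(2)] Lder_divide[OF bb]
    unfolding Fract_eq_divide[of a b] Fract_eq_divide[of a' b'] dpoly_mult dpoly_add e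
    using nz by (simp add: divide_simps del: mult_fract divide_fract add_fract) algebra
qed

lemma Lder_diff: "Lder (f - g) = Lder f - Lder g"
  using Lder_add[of "f - g" g] by simp

lemma Lder_quot:
  assumes "g \<noteq> 0"
  shows "Lder (f / g) = (Lder f * g - f * Lder g) / g^2"
  using Lder_mult[of "f / g" g] assms by (simp add: field_simps power2_eq_square)

lemma Lder_Var: "Lder (Var v) = dgen v"
proof -
  have d1: "dpoly 1 = 0" using dpoly_single[of 0 1] by (simp add: log_deriv_def)
  have "log_deriv (Poly_Mapping.single v 1) = (\<Sum>w\<in>UNIV. if w = v then dgen v / Var v else 0)"
    unfolding log_deriv_def by (rule sum.cong) (auto simp: lookup_single when_def)
  then have "dpoly (Poly_Mapping.single (Poly_Mapping.single v 1) 1) = dgen v"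
    by (simp add: dpoly_single)
  then show ?thesis
    unfolding Var_def by (subst Lder_divide) (simp_all add: d1 fract_collapse)
qed

subsection \<open>Weyl group substitutions and evaluation\<close>

text \<open>It serves twice: with \<open>p = s_gen 1\<close> and \<open>p' = Var\<close> it
  expresses that \<open>s_1\<close> is an involution, and with polynomial points it gives the action
  on states. Assumptions \<open>t\<close> and \<open>d\<close> fix the new values of
  \<open>tau_1\<close> and its derivative with denominators cleared.\<close>

lemma (in const_hom) ev_at_reflect1:
  assumes "p Vt1 \<noteq> 0"
    and "p' Va0 = p Va0 + p Va1" "p' Va1 = - p Va1" "p' Vx = p Vx"
    and "p' Vt0 = p Vt0" "p' Vt2 = p Vt2" "p' Vd0 = p Vd0" "p' Vd2 = p Vd2"
    and t: "p' Vt1 * p Vt1 = p Vd2 * p Vt0 - p Vt2 * p Vd0 + p Vx * p Vt2 * p Vt0"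
    and d: "p' Vd1 * (p Vt1)^2 = (p Vd2 * p Vt0 - p Vt2 * p Vd0 + p Vx * p Vt2 * p Vt0) * p Vd1
      + p Va1 * p Vt2 * p Vt0 * p Vt1"
    and L: "Lder (new_tau 1) = ((tau' 2 * tau 0 - tau 2 * tau' 0 + xL * tau 2 * tau 0) * tau' 1
      + alpha 1 * tau 2 * tau 0 * tau 1) / (tau 1)^2"
  shows "ev_at p (s_gen 1 v) (p' v)"
proof (cases v)
  case Vt1
  have "ev_at p (new_tau 1) (p' Vt1)"
    unfolding new_tau_def using assms(1)
    by (intro ev_at_divide[of p _ _ "p Vt1"], unfold t)
      (auto intro!: ev_at_intros simp: tau_def tau'_def xL_def tv_def dv_def)
  then show ?thesis by (simp add: Vt1 s_img_t_def)
next
  case Vd1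
  have "ev_at p (Lder (new_tau 1)) (p' Vd1)"
    unfolding L using assms(1)
    by (intro ev_at_divide[of p _ _ "(p Vt1)^2"], unfold d)
      (auto intro!: ev_at_intros simp: tau_def tau'_def xL_def tv_def dv_def alpha_def)
  then show ?thesis by (simp add: Vd1 s_img_d_def)
qed (use assms in \<open>auto intro!: ev_at_intros simp: s_alpha_def s_img_t_def s_img_d_def
    tau_def tau'_def xL_def tv_def dv_def alpha_def\<close>)

lemma (in const_hom) ev_at_reflect2:
  assumes "p Vt2 \<noteq> 0"
    and "p' Va0 = p Va0 + (3 - p Va0 - p Va1)" "p' Va1 = p Va1 + (3 - p Va0 - p Va1)"
    and "p' Vx = p Vx"
    and "p' Vt0 = p Vt0" "p' Vt1 = p Vt1" "p' Vd0 = p Vd0" "p' Vd1 = p Vd1"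
    and t: "p' Vt2 * p Vt2 = p Vd0 * p Vt1 - p Vt0 * p Vd1 + p Vx * p Vt0 * p Vt1"
    and d: "p' Vd2 * (p Vt2)^2 = (p Vd0 * p Vt1 - p Vt0 * p Vd1 + p Vx * p Vt0 * p Vt1) * p Vd2
      + (3 - p Va0 - p Va1) * p Vt0 * p Vt1 * p Vt2"
    and L: "Lder (new_tau 2) = ((tau' 0 * tau 1 - tau 0 * tau' 1 + xL * tau 0 * tau 1) * tau' 2
      + alpha 2 * tau 0 * tau 1 * tau 2) / (tau 2)^2"
  shows "ev_at p (s_gen 2 v) (p' v)"
proof (cases v)
  case Vt2
  have "ev_at p (new_tau 2) (p' Vt2)"
    unfolding new_tau_def using assms(1)
    by (intro ev_at_divide[of p _ _ "p Vt2"], unfold t)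
      (auto intro!: ev_at_intros simp: tau_def tau'_def xL_def tv_def dv_def)
  then show ?thesis by (simp add: Vt2 s_img_t_def)
next
  case Vd2
  have "ev_at p (Lder (new_tau 2)) (p' Vd2)"
    unfolding L using assms(1)
    by (intro ev_at_divide[of p _ _ "(p Vt2)^2"], unfold d)
      (auto intro!: ev_at_intros simp: tau_def tau'_def xL_def tv_def dv_def alpha_def)
  then show ?thesis by (simp add: Vd2 s_img_d_def)
qed (use assms in \<open>auto intro!: ev_at_intros simp: s_alpha_def s_img_t_def s_img_d_def
    tau_def tau'_def xL_def tv_def dv_def alpha_def\<close>)

section \<open>Derivatives of the reflected tau functions\<close>

interpretation pconst: const_hom "\<lambda>c :: complex. [:c:]"
  by unfold_locales (simp_all flip: one_pCons)

lemma Lfld_3_nonzero: "(3 :: Lfld) \<noteq> 0"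
  using pconst.ev_at_unique[OF pconst.ev_at_3, of seed 0] pconst.ev_at_0[of seed] by auto

lemma tau_nonzero [simp]: "tau i \<noteq> 0"
  by (simp add: tau_def)

text \<open>At the seed the numerator takes the value x, so it cannot be zero in L.\<close>

lemma new_tau_nonzero: "new_tau i \<noteq> 0"
proof -
  let ?N = "tau' (i+1) * tau (i+2) - tau (i+1) * tau' (i+2) + xL * tau (i+1) * tau (i+2)"
  have tau: "pconst.ev_at seed (tau j) 1" and tau': "pconst.ev_at seed (tau' j) 0" for j
    using pconst.ev_at_Var[of seed "tv j"] pconst.ev_at_Var[of seed "dv j"]
    by (auto simp: tau_def tau'_def tv_def dv_def split: if_splits)
  have x: "pconst.ev_at seed xL [:0, 1:]"
    using pconst.ev_at_Var[of seed Vx] by (simp add: xL_def)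
  have "pconst.ev_at seed ?N (0 * 1 - 1 * 0 + [:0, 1:] * 1 * 1)"
    by (intro pconst.ev_at_intros tau tau' x)
  then have "?N \<noteq> 0"
    using pconst.ev_at_unique[OF pconst.ev_at_0] by fastforce
  then show ?thesis by (simp add: new_tau_def)
qed

text \<open>The counterpart of \<open>br_hirota\<close> inside L, with \<open>g0\<close>,
  \<open>g1\<close>, \<open>g2\<close> for the logarithmic derivatives and \<open>G1\<close>,
  \<open>G2\<close> for their derivatives. Divided by \<open>p q\<close>, the left side is
  \<open>G1 - G2 + (x + g1 - g2) (g1 + g2) + 1\<close>.\<close>

lemma log_derivative_difference:
  fixes t p q g0 g1 g2 x a a1 a2 :: "'a::field"
  assumes "t \<noteq> 0" "p \<noteq> 0" "q \<noteq> 0" "(3::'a) \<noteq> 0" "a + a1 + a2 = 3"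
    and G1: "3 * G1 = 3 * (- x * (g2 - g0) - (g1 - g2) * (g1 - g0)) - (a2 - a)"
    and G2: "3 * G2 = 3 * (- x * (g0 - g1) - (g2 - g0) * (g2 - g1)) - (a - a1)"
    and p': "p' = p * g1" "q' = q * g2" "t' = t * g0"
  shows "(p * (G1 + g1^2)) * q + p' * q' - (p' * q' + p * (q * (G2 + g2^2)))
      + ((1 * p + x * p') * q + x * p * q')
    = (p' * q - p * q' + x * p * q) * (2 * g0) + a * p * q"
proof -
  \<comment> \<open>The value of \<open>G1 - G2\<close>; its constant
    \<open>(2 a - a1 - a2) / 3\<close> equals \<open>a - 1\<close> because the parameters sum to
    3.\<close>
  let ?D = "a - 1 - (x + g1 - g2) * (g1 + g2 - 2 * g0)"
  have a2: "a2 = 3 - a - a1" using assms(5) by (simp add: algebra_simps)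
  have "3 * (G1 - G2) = 3 * ?D"
    unfolding right_diff_distrib[of 3 G1 G2] G1 G2 a2 by (simp add: algebra_simps)
  then have G: "G1 = G2 + ?D"
    using assms(4) by (subst (asm) mult_cancel_left) (simp add: algebra_simps)
  show ?thesis
    unfolding p' G by (simp add: algebra_simps power2_eq_square)
qed

lemma period3:
  "tau (j + 3) = tau j" "tau' (j + 3) = tau' j" "alpha (j + 3) = alpha j"
  "Fp (j + 3) = Fp j" "Fpp (j + 3) = Fpp j"
proof -
  show *: "tau (j + 3) = tau j" "tau' (j + 3) = tau' j" "alpha (j + 3) = alpha j" for j
    by (simp_all add: tau_def tau'_def alpha_def tv_def dv_def)
  then show **: "Fp (j + 3) = Fp j" for j by (simp add: Fp_def)
  have "j + 3 + 1 = j + 1 + 3" "j + 3 + 2 = j + 2 + 3" by simp_all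
  then show "Fpp (j + 3) = Fpp j"
    unfolding Fpp_def by (simp only: * **)
qed

lemma mod3_induct:
  fixes j :: nat
  assumes "P 0" "P 1" "P 2" "\<And>j. P j \<Longrightarrow> P (j + 3)"
  shows "P j"
proof (induction j rule: less_induct)
  case (less j)
  show ?case
  proof (cases "j < 3")
    case True
    then have "j = 0 \<or> j = 1 \<or> j = 2" by linarith
    with assms(1-3) show ?thesis by blast
  next
    case False
    with less assms(4)[of "j - 3"] show ?thesis by simp
  qed
qed

lemma alpha_sum: "alpha i + alpha (i + 1) + alpha (i + 2) = 3"
proof (induction i rule: mod3_induct)
  case (4 j)
  have "j + 3 + 1 = j + 1 + 3" "j + 3 + 2 = j + 2 + 3" by simp_all
  with 4 show ?case by (simp only: period3)
qed (simp_all add: alpha_def)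

lemma Lder_tau: "Lder (tau j) = tau' j"
  by (simp add: tau_def tau'_def Lder_Var tv_def dv_def)

lemma Lder_tau': "Lder (tau' j) = tau j * (Fpp j + (Fp j)^2)"
proof (induction j rule: mod3_induct)
  case (4 j)
  then show ?case by (simp only: period3)
qed (simp_all add: tau'_def dv_def Lder_Var)

text \<open>The numerator satisfies \<open>N' = 2 N Fp i + alpha i tau (i+1) tau (i+2)\<close>, and
  the quotient rule takes away one \<open>N Fp i\<close>. The result is free of second derivatives,
  as \<open>ev_at_reflect1\<close> and \<open>ev_at_reflect2\<close> require.\<close>

lemma Lder_new_tau:
  "Lder (new_tau i) = ((tau' (i+1) * tau (i+2) - tau (i+1) * tau' (i+2)
      + xL * tau (i+1) * tau (i+2)) * tau' i
      + alpha i * tau (i+1) * tau (i+2) * tau i) / (tau i)^2"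
proof -
  let ?N = "tau' (i+1) * tau (i+2) - tau (i+1) * tau' (i+2) + xL * tau (i+1) * tau (i+2)"
  have tau': "tau' j = tau j * Fp j" for j by (simp add: Fp_def)
  have x: "Lder xL = 1" by (simp add: xL_def Lder_Var)
  have three: "3 * (y / 3) = y" for y :: Lfld using Lfld_3_nonzero by simp
  have idx: "i + 1 + 1 = i + 2" "i + 1 + 2 = i + 3" "i + 2 + 1 = i + 3" "i + 2 + 2 = i + 1 + 3"
    by simp_all
  have G: "3 * Fpp (i+1) = 3 * (- xL * (Fp (i+2) - Fp i) - (Fp (i+1) - Fp (i+2)) * (Fp (i+1) - Fp i))
      - (alpha (i+2) - alpha i)"
    "3 * Fpp (i+2) = 3 * (- xL * (Fp i - Fp (i+1)) - (Fp (i+2) - Fp i) * (Fp (i+2) - Fp (i+1)))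
      - (alpha i - alpha (i+1))"
    unfolding Fpp_def idx period3 by (simp_all only: right_diff_distrib three)
  have "Lder ?N = tau (i+1) * (Fpp (i+1) + (Fp (i+1))^2) * tau (i+2) + tau' (i+1) * tau' (i+2)
      - (tau' (i+1) * tau' (i+2) + tau (i+1) * (tau (i+2) * (Fpp (i+2) + (Fp (i+2))^2)))
      + ((1 * tau (i+1) + xL * tau' (i+1)) * tau (i+2) + xL * tau (i+1) * tau' (i+2))"
    unfolding Lder_add Lder_diff Lder_mult Lder_tau Lder_tau' x ..
  also have "\<dots> = ?N * (2 * Fp i) + alpha i * tau (i+1) * tau (i+2)"
    by (rule log_derivative_difference[OF _ _ _ Lfld_3_nonzero alpha_sum G tau' tau' tau']) simp_all
  finally have "Lder ?N * tau i - ?N * tau' i = ?N * tau' i + alpha i * tau (i+1) * tau (i+2) * tau i"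
    using tau'[of i] by algebra
  then show ?thesis
    unfolding new_tau_def Lder_quot[OF tau_nonzero] Lder_tau by simp
qed

lemma index_simps: "(1::nat) + 1 = 2" "(1::nat) + 2 = 3" "(2::nat) + 1 = 3" "(2::nat) + 2 = 4"
    "tau 3 = tau 0" "tau' 3 = tau' 0" "tau 4 = tau 1" "tau' 4 = tau' 1"
  by (simp_all add: tau_def tau'_def tv_def dv_def)

lemmas new_tau_1 = new_tau_def[of 1, unfolded index_simps]
lemmas new_tau_2 = new_tau_def[of 2, unfolded index_simps]
lemmas Lder_new_tau_1 = Lder_new_tau[of 1, unfolded index_simps]
lemmas Lder_new_tau_2 = Lder_new_tau[of 2, unfolded index_simps]

text \<open>As \<open>s_1\<close> is an involution, \<open>s_gen 1\<close> can itself serve as the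
  point at which its images evaluate back to the variables.\<close>

lemma injective_s_gen_1: "injective_subst (s_gen 1)"
proof (rule injective_substI)
  show "mconst.ev_at (s_gen 1) (s_gen 1 v) (Var v)" for v
  proof (rule mconst.ev_at_reflect1[OF _ _ _ _ _ _ _ _ _ _ Lder_new_tau_1])
    show "s_gen 1 Vt1 \<noteq> 0" by (simp add: s_img_t_def new_tau_nonzero)
    show "Var Vt1 * s_gen 1 Vt1 = s_gen 1 Vd2 * s_gen 1 Vt0 - s_gen 1 Vt2 * s_gen 1 Vd0
        + s_gen 1 Vx * s_gen 1 Vt2 * s_gen 1 Vt0"
      by (simp add: s_img_t_def s_img_d_def new_tau_1[simplified]) (simp add: tau_def tau'_def tv_def dv_def)
    \<comment> \<open>The sign change of \<open>alpha 1\<close> under \<open>s_1\<close> cancels the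
      \<open>alpha 1\<close> term contributed by \<open>Lder (new_tau 1)\<close>.\<close>
    have "tau' 1 * (new_tau 1)\<^sup>2 =
        (tau' 2 * tau 0 - tau 2 * tau' 0 + xL * tau 2 * tau 0) * Lder (new_tau 1)
        + (- alpha 1) * tau 2 * tau 0 * new_tau 1"
      unfolding Lder_new_tau_1 unfolding new_tau_1 by (simp add: field_simps power2_eq_square)
    then show "Var Vd1 * (s_gen 1 Vt1)\<^sup>2 = (s_gen 1 Vd2 * s_gen 1 Vt0 - s_gen 1 Vt2 * s_gen 1 Vd0
        + s_gen 1 Vx * s_gen 1 Vt2 * s_gen 1 Vt0) * s_gen 1 Vd1
        + s_gen 1 Va1 * s_gen 1 Vt2 * s_gen 1 Vt0 * s_gen 1 Vt1"
      by (simp add: s_img_t_def s_img_d_def s_alpha_def) (simp add: tau'_def dv_def)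
  qed (simp_all add: s_alpha_def s_img_t_def s_img_d_def alpha_def tau_def tau'_def xL_def tv_def dv_def)
qed

lemma injective_s_gen_2: "injective_subst (s_gen 2)"
proof (rule injective_substI)
  have a2: "3 - s_gen 2 Va0 - s_gen 2 Va1 = - alpha 2"
    by (simp add: s_alpha_def alpha_def)
  show "mconst.ev_at (s_gen 2) (s_gen 2 v) (Var v)" for v
  proof (rule mconst.ev_at_reflect2[OF _ _ _ _ _ _ _ _ _ _ Lder_new_tau_2])
    show "s_gen 2 Vt2 \<noteq> 0" by (simp add: s_img_t_def new_tau_nonzero)
    show "Var Vt2 * s_gen 2 Vt2 = s_gen 2 Vd0 * s_gen 2 Vt1 - s_gen 2 Vt0 * s_gen 2 Vd1
        + s_gen 2 Vx * s_gen 2 Vt0 * s_gen 2 Vt1"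
      by (simp add: s_img_t_def s_img_d_def new_tau_2[simplified]) (simp add: tau_def tau'_def tv_def dv_def)
    have "tau' 2 * (new_tau 2)\<^sup>2 =
        (tau' 0 * tau 1 - tau 0 * tau' 1 + xL * tau 0 * tau 1) * Lder (new_tau 2)
        + (- alpha 2) * tau 0 * tau 1 * new_tau 2"
      unfolding Lder_new_tau_2 unfolding new_tau_2 by (simp add: field_simps power2_eq_square)
    then show "Var Vd2 * (s_gen 2 Vt2)\<^sup>2 = (s_gen 2 Vd0 * s_gen 2 Vt1 - s_gen 2 Vt0 * s_gen 2 Vd1
        + s_gen 2 Vx * s_gen 2 Vt0 * s_gen 2 Vt1) * s_gen 2 Vd2
        + (3 - s_gen 2 Va0 - s_gen 2 Va1) * s_gen 2 Vt0 * s_gen 2 Vt1 * s_gen 2 Vt2"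
      unfolding a2
      by (simp add: s_img_t_def s_img_d_def) (simp add: tau'_def dv_def)
  qed (simp_all add: s_alpha_def s_img_t_def s_img_d_def alpha_def tau_def tau'_def xL_def tv_def dv_def)
qed

context const_hom
begin

lemma ev_at_alpha: "ev_at p (alpha 0) (p Va0)" "ev_at p (alpha 1) (p Va1)"
  "ev_at p (alpha 2) (3 - p Va0 - p Va1)"
  by (auto intro!: ev_at_intros simp: alpha_def)

lemma ev_at_pi_gen:
  assumes "p' Va0 = p Va1" "p' Va1 = 3 - p Va0 - p Va1" "p' Vx = p Vx"
    "p' Vt0 = p Vt1" "p' Vt1 = p Vt2" "p' Vt2 = p Vt0"
    "p' Vd0 = p Vd1" "p' Vd1 = p Vd2" "p' Vd2 = p Vd0"
  shows "ev_at p (pi_gen v) (p' v)"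
  using assms by (cases v) (auto intro!: ev_at_intros ev_at_alpha ev_at_alpha(2)[unfolded One_nat_def]
      simp: tau_def tau'_def xL_def tv_def dv_def)

lemma ev_at_piinv_gen:
  assumes "p' Va0 = 3 - p Va0 - p Va1" "p' Va1 = p Va0" "p' Vx = p Vx"
    "p' Vt0 = p Vt2" "p' Vt1 = p Vt0" "p' Vt2 = p Vt1"
    "p' Vd0 = p Vd2" "p' Vd1 = p Vd0" "p' Vd2 = p Vd1"
  shows "ev_at p (piinv_gen v) (p' v)"
  using assms by (cases v) (auto intro!: ev_at_intros ev_at_alpha ev_at_alpha(2)[unfolded One_nat_def]
      simp: tau_def tau'_def xL_def tv_def dv_def)

end

lemma injective_pi_gen: "injective_subst pi_gen"
  by (rule injective_substI[of piinv_gen], rule mconst.ev_at_pi_gen)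
    (simp_all add: alpha_def tau_def tau'_def xL_def tv_def dv_def)

lemma injective_piinv_gen: "injective_subst piinv_gen"
  by (rule injective_substI[of pi_gen], rule mconst.ev_at_piinv_gen)
    (simp_all add: alpha_def tau_def tau'_def xL_def tv_def dv_def)

section \<open>Evaluation of the translations and of \<open>tau_mn\<close> at states\<close>

fun point :: "state \<Rightarrow> var \<Rightarrow> complex poly" where
  "point (a0, a1, a2, t0, t1, t2) v = (case v of Va0 \<Rightarrow> [:a0:] | Va1 \<Rightarrow> [:a1:] | Vx \<Rightarrow> [:0, 1:]
     | Vt0 \<Rightarrow> t0 | Vt1 \<Rightarrow> t1 | Vt2 \<Rightarrow> t2
     | Vd0 \<Rightarrow> pderiv t0 | Vd1 \<Rightarrow> pderiv t1 | Vd2 \<Rightarrow> pderiv t2)"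

abbreviation ev :: "state \<Rightarrow> Lfld \<Rightarrow> complex poly \<Rightarrow> bool" where
  "ev X \<equiv> pconst.ev_at (point X)"

lemma ev_s1:
  assumes "good X" "ev (refl1 X) f q"
  shows "ev X (s 1 f) q"
proof (cases X)
  case [simp]: (fields a0 a1 a2 t0 t1 t2)
  interpret bilinear_triple a0 a1 a2 t0 t1 t2
    using assms(1) by (simp add: good_def)
  have u: "br t2 t0 div t1 = u" by (simp add: u_def)
  have "ev X (s_gen 1 v) (point (refl1 X) v)" for v
  proof (rule pconst.ev_at_reflect1[OF _ _ _ _ _ _ _ _ _ _ Lder_new_tau_1])
    have "u * t1 = pderiv t2 * t0 - t2 * pderiv t0 + [:0, 1:] * t2 * t0"
      unfolding u_mult br_def ..
    then show "point (refl1 X) Vt1 * point X Vt1 = point X Vd2 * point X Vt0 - point X Vt2 * point X Vd0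
        + point X Vx * point X Vt2 * point X Vt0"
      by (simp only: fields refl1.simps u point.simps var.case)
    \<comment> \<open>This is \<open>u_deriv\<close> times \<open>t1\<close>, with
      \<open>u t1\<close> replaced by its bilinear expression.\<close>
    have "pderiv u * t1^2 = (pderiv t2 * t0 - t2 * pderiv t0 + [:0, 1:] * t2 * t0) * pderiv t1
        + [:a1:] * t2 * t0 * t1"
      using u_deriv u_mult[unfolded br_def] by algebra
    then show "point (refl1 X) Vd1 * (point X Vt1)\<^sup>2 = (point X Vd2 * point X Vt0 - point X Vt2 * point X Vd0
        + point X Vx * point X Vt2 * point X Vt0) * point X Vd1
        + point X Va1 * point X Vt2 * point X Vt0 * point X Vt1"
      by (simp only: fields refl1.simps u point.simps var.case)
  qed (use nonzero in simp_all)
  then show ?thesis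
    using pconst.ev_at_subst[OF injective_s_gen_1 _ assms(2)] by (simp add: s_def)
qed

lemma ev_s2:
  assumes "good X" "ev (refl2 X) f q"
  shows "ev X (s 2 f) q"
proof (cases X)
  case [simp]: (fields a0 a1 a2 t0 t1 t2)
  interpret bilinear_triple a0 a1 a2 t0 t1 t2
    using assms(1) by (simp add: good_def)
  have v: "br t0 t1 div t2 = v" by (simp add: v_def)
  have a2: "[:a2:] = 3 - [:a0:] - [:a1:]"
    unfolding const_sum by simp
  have "ev X (s_gen 2 w) (point (refl2 X) w)" for w
  proof (rule pconst.ev_at_reflect2[OF _ _ _ _ _ _ _ _ _ _ Lder_new_tau_2])
    have "v * t2 = pderiv t0 * t1 - t0 * pderiv t1 + [:0, 1:] * t0 * t1"
      unfolding v_mult br_def ..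
    then show "point (refl2 X) Vt2 * point X Vt2 = point X Vd0 * point X Vt1 - point X Vt0 * point X Vd1
        + point X Vx * point X Vt0 * point X Vt1"
      by (simp only: fields rot.simps rotinv.simps refl1.simps v point.simps var.case)
    have "pderiv v * t2^2 = (pderiv t0 * t1 - t0 * pderiv t1 + [:0, 1:] * t0 * t1) * pderiv t2
        + (3 - [:a0:] - [:a1:]) * t0 * t1 * t2"
      using v_deriv[unfolded a2] v_mult[unfolded br_def] by algebra
    then show "point (refl2 X) Vd2 * (point X Vt2)\<^sup>2 = (point X Vd0 * point X Vt1 - point X Vt0 * point X Vd1
        + point X Vx * point X Vt0 * point X Vt1) * point X Vd2
        + (3 - point X Va0 - point X Va1) * point X Vt0 * point X Vt1 * point X Vt2"
      by (simp only: fields rot.simps rotinv.simps refl1.simps v point.simps var.case)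
  qed (use nonzero a2[symmetric] in simp_all)
  then show ?thesis
    using pconst.ev_at_subst[OF injective_s_gen_2 _ assms(2)] by (simp add: s_def)
qed

lemma ev_pi:
  assumes "good X" "ev (rot X) f q"
  shows "ev X (Defs.pi f) q"
proof (cases X)
  case [simp]: (fields a0 a1 a2 t0 t1 t2)
  interpret bilinear_triple a0 a1 a2 t0 t1 t2
    using assms(1) by (simp add: good_def)
  have "ev X (pi_gen v) (point (rot X) v)" for v
    by (rule pconst.ev_at_pi_gen) (use const_sum in \<open>simp_all add: algebra_simps\<close>)
  then show ?thesis
    using pconst.ev_at_subst[OF injective_pi_gen _ assms(2)] by (simp add: pi_def)
qed

lemma ev_piinv:
  assumes "good X" "ev (rotinv X) f q"
  shows "ev X (piinv f) q"
proof (cases X)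
  case [simp]: (fields a0 a1 a2 t0 t1 t2)
  interpret bilinear_triple a0 a1 a2 t0 t1 t2
    using assms(1) by (simp add: good_def)
  have "ev X (piinv_gen v) (point (rotinv X) v)" for v
    by (rule pconst.ev_at_piinv_gen) (use const_sum in \<open>simp_all add: algebra_simps\<close>)
  then show ?thesis
    using pconst.ev_at_subst[OF injective_piinv_gen _ assms(2)] by (simp add: piinv_def)
qed

lemma ev_shift:
  assumes "good X"
  shows "ev (shift1 X) f q \<Longrightarrow> ev X (T1 f) q"
    and "ev (shift2 X) f q \<Longrightarrow> ev X (T2 f) q"
    and "ev (shift1_inv X) f q \<Longrightarrow> ev X (T1inv f) q"
    and "ev (shift2_inv X) f q \<Longrightarrow> ev X (T2inv f) q"
  using assms unfolding T1_def T2_def T1inv_def T2inv_def shift_defs comp_def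
  by (auto intro!: ev_s1[unfolded One_nat_def] ev_s2 ev_pi ev_piinv simp: good_refl1)

text \<open>Each application of \<open>T\<close> to the function is traded for one step of
  \<open>h\<close> on the point; goodness of the point must persist for the next trade.\<close>

lemma ev_zpow:
  assumes T: "\<And>X f. good X \<Longrightarrow> ev (h X) f q \<Longrightarrow> ev X (T f) q"
    "\<And>X f. good X \<Longrightarrow> ev (h' X) f q \<Longrightarrow> ev X (T' f) q"
    and h: "\<And>X. good X \<Longrightarrow> good (h X)" "\<And>X. good X \<Longrightarrow> good (h' X)"
    and X: "good X" "ev (zpow h h' k X) f q"
  shows "ev X (zpow T T' k f) q"
proof -
  have *: "ev X ((T ^^ n) f) q" if "good X" "ev ((h ^^ n) X) f q"
    and T: "\<And>X f. good X \<Longrightarrow> ev (h X) f q \<Longrightarrow> ev X (T f) q"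
    and h: "\<And>X. good X \<Longrightarrow> good (h X)" for n X h T
    using that(1,2)
  proof (induction n arbitrary: X)
    case (Suc n)
    then have "ev (h X) ((T ^^ n) f) q" by (simp add: h funpow_swap1)
    with Suc.prems(1) show ?case by (simp add: T)
  qed simp
  show ?thesis
    using X *[OF _ _ T(1) h(1)] *[OF _ _ T(2) h(2)] by (auto simp: zpow_def split: if_splits)
qed

lemma ev_tau_mn: "ev seed_state (tau_mn m n) (okamoto m n)"
proof -
  have "pconst.ev_at p (tau 0) (p Vt0)" for p
    using pconst.ev_at_Var[of p Vt0] by (simp add: tau_def tv_def)
  then have "ev (lattice m n) (tau 0) (okamoto m n)"
    unfolding okamoto_def by (cases "lattice m n") (metis point.simps tau_zero.simps var.case(4))
  then show ?thesis
    unfolding tau_mn_def lattice_def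
    by (intro ev_zpow[where h = shift1 and h' = shift1_inv]
        ev_zpow[where h = shift2 and h' = shift2_inv] ev_shift good_shift good_seed)
      (simp_all add: zpow_shift1)
qed

lemma point_seed: "point seed_state = seed"
proof
  show "point seed_state v = seed v" for v
    by (cases v) (simp_all add: seed_state_def flip: one_pCons)
qed

lemma evaluates_to_ev: "ev seed_state f q \<Longrightarrow> evaluates_to f q"
  unfolding pconst.ev_at_def point_seed evaluates_to_def evseed_def
  using pconst.evalm_nonzeroD by blast

theorem theorem4p3:
  "\<exists>Q :: int \<Rightarrow> int \<Rightarrow> complex poly.
     (\<forall>m n. evaluates_to (tau_mn m n) (Q m n)) \<and>
     toda_eqs Q \<and> toda_init Q \<and>
     (\<forall>P :: int \<Rightarrow> int \<Rightarrow> complex poly. toda_eqs P \<and> toda_init P \<longrightarrow> P = Q)"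
  using evaluates_to_ev[OF ev_tau_mn] toda_okamoto init_okamoto toda_unique by blast

end
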